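(* Let $n\geq 2$ be an integer, let $m$ be an integer with $\frac{n}{2}<m<+\infty$, let $-\infty<a<n$ and $1<p<+\infty$, and let $u$ be a nonnegative (classical) solution of the super-critical order Hardy–Hénon inequality $$(-\Delta)^{m}u(x)\geq\frac{u^{p}(x)}{|x|^{a}}\quad\text{in }\mathbb{R}^{n},\qquad u(x)\geq 0,\ x\in\mathbb{R}^{n},$$ where $u\in C^{2m}(\mathbb{R}^{n})$ if $-\infty<a\leq 0$, and $u\in C^{2m}(\mathbb{R}^{n}\setminus\{0\})\cap C^{2m-2}(\mathbb{R}^{n})$ if $0<a<n$. Suppose that at least one of the following two assumptions holds: $$-\infty<a\leq 2+2p,\qquad\text{or}\qquad u(x)=o(|x|^{2})\ \text{ as }|x|\to+\infty.$$ Then $u\equiv 0$ in $\mathbb{R}^{n}$.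
   Context: Solutions are classical: the inequality holds pointwise. When $0<a<n$ it is understood pointwise at every $x\neq 0$ (where $u$ is $C^{2m}$ and $|x|^{-a}$ is finite). *)

theory Defs
  imports "HOL-Analysis.Analysis" "HOL-Library.Landau_Symbols"
begin

definition partial :: "'n \<Rightarrow> (real ^ 'n::finite \<Rightarrow> real) \<Rightarrow> real ^ 'n \<Rightarrow> real" where
  "partial i f x = deriv (\<lambda>t. f (x + t *\<^sub>R axis i 1)) 0"

definition has_partial_at :: "'n \<Rightarrow> (real ^ 'n::finite \<Rightarrow> real) \<Rightarrow> real ^ 'n \<Rightarrow> bool" where
  "has_partial_at i f x \<longleftrightarrow> (\<lambda>t. f (x + t *\<^sub>R axis i 1)) field_differentiable (at 0)"

text \<open>The space $C^k(S)$, intended for open \<open>S\<close>: all iterated partial derivatives of order at most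
  \<open>k\<close> exist at every point of \<open>S\<close> and are continuous on \<open>S\<close>.\<close>

fun C_on :: "nat \<Rightarrow> (real ^ 'n::finite \<Rightarrow> real) \<Rightarrow> (real ^ 'n) set \<Rightarrow> bool" where
  "C_on 0 f S \<longleftrightarrow> continuous_on S f"
| "C_on (Suc k) f S \<longleftrightarrow> continuous_on S f \<and>
     (\<forall>i. (\<forall>x\<in>S. has_partial_at i f x) \<and> C_on k (partial i f) S)"

definition laplacian :: "(real ^ 'n::finite \<Rightarrow> real) \<Rightarrow> real ^ 'n \<Rightarrow> real" where
  "laplacian f x = (\<Sum>i\<in>UNIV. partial i (partial i f) x)"

definition neg_laplacian_pow :: "nat \<Rightarrow> (real ^ 'n::finite \<Rightarrow> real) \<Rightarrow> real ^ 'n \<Rightarrow> real" where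
  "neg_laplacian_pow m = (\<lambda>f x. - laplacian f x) ^^ m"

text \<open>The weight $|x|^{-a}$. The case \<open>a = 0\<close> is separated because \<open>0 powr 0 = 0\<close> in HOL, whereas the
  weight is identically 1 then. For \<open>a < 0\<close> the value at the origin is 0, as it should be;
  for \<open>a > 0\<close> the origin is excluded in the definition of a solution below.\<close>

definition hardy_henon_weight :: "real \<Rightarrow> real ^ 'n::finite \<Rightarrow> real" where
  "hardy_henon_weight a x = (if a = 0 then 1 else norm x powr (- a))"

definition classical_solution ::
    "nat \<Rightarrow> real \<Rightarrow> real \<Rightarrow> (real ^ 'n::finite \<Rightarrow> real) \<Rightarrow> bool" where
  "classical_solution m a p u \<longleftrightarrow>
     (if a \<le> 0
      then C_on (2 * m) u UNIV \<and>
           (\<forall>x. neg_laplacian_pow m u x \<ge> u x powr p * hardy_henon_weight a x)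
      else C_on (2 * m) u (UNIV - {0}) \<and> C_on (2 * m - 2) u UNIV \<and>
           (\<forall>x. x \<noteq> 0 \<longrightarrow> neg_laplacian_pow m u x \<ge> u x powr p * hardy_henon_weight a x))"

end

theory Submission
  imports Defs
begin

text \<open>The proof is by the test function method. A continuous function that is superharmonic off the origin
  is superharmonic in the weak sense across it, because \<open>n \<ge> 2\<close>; so the inequality holds weakly on the
  whole space. Test it with \<open>\<phi>(x / R)\<close>, where \<open>\<phi> = w ^ K\<close> and \<open>w x = max 0 (1 - |x|\<^sup>2)\<close>. Then
  \<open>(-\<Delta>) ^ m \<phi>\<close> is \<open>O(w ^ (K - 2 * m))\<close>, hence \<open>O(w powr (K / p))\<close> for large \<open>K\<close>, and Young's inequality
  absorbs the right-hand side into the left up to a remainder of order \<open>R\<close> to the power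
  \<open>n - 2 * m + (max a 0 - 2 * m) / (p - 1)\<close>. This exponent is negative since \<open>a < n < 2 * m\<close>.\<close>

section \<open>The classes $C^k$\<close>

text \<open>Absorbing the right-hand side needs |(-\<Delta>)^m \<phi>| \<le> C \<phi>^(1/p), so
  \<phi> must vanish to high order at the edge of its support. For a power of a truncated polynomial
  this is visible algebraically: every derivative lowers the exponent by one and leaves a smooth
  coefficient.

  Only the outermost Laplacian meets the singularity, because (-\<Delta>)^(m-1) u is still
  continuous at 0. Testing the whole power at once uses the sign of (-\<Delta>)^m u alone and no
  sign of the lower powers.

  Near the origin absorption fails: the weight may degenerate there (a < 0), or (-\<Delta>)^m u may
  not exist at 0 (a > 0). So the left-hand side is kept only on |x| \<ge> r, and on |x| < r the
  function u is simply bounded by a constant; that region contributes O(R^(-2m)), which tends to 0.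
  On r \<le> |x| \<le> R the weight is at least a constant times R^(-max a 0), which is where max a
  0 comes from. Finally, \<phi>(x / R) increases with R, so a left-hand side that tends to 0 as R
  grows must vanish already for each fixed R.\<close>

definition has_pd :: "'n \<Rightarrow> (real ^ 'n::finite \<Rightarrow> real) \<Rightarrow> real \<Rightarrow> real ^ 'n \<Rightarrow> bool" where
  "has_pd i f D x \<longleftrightarrow> ((\<lambda>t. f (x + t *\<^sub>R axis i 1)) has_real_derivative D) (at 0)"

lemma has_pd_partial: "has_partial_at i f x \<Longrightarrow> has_pd i f (partial i f x) x"
  unfolding has_pd_def has_partial_at_def partial_def by (rule iffD2[OF DERIV_deriv_iff_field_differentiable])

lemma has_pdD:
  assumes "has_pd i f D x"
  shows "has_partial_at i f x" "partial i f x = D"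
  using assms by (auto simp: has_pd_def has_partial_at_def partial_def field_differentiable_def intro: DERIV_imp_deriv)

lemma eventually_line:
  assumes "open S" "x \<in> S"
  shows "\<forall>\<^sub>F t in nhds 0. x + t *\<^sub>R axis i (1::real) \<in> S"
proof -
  have "((\<lambda>t. x + t *\<^sub>R axis i (1::real)) \<longlongrightarrow> x + 0 *\<^sub>R axis i 1) (nhds 0)"
    by (intro tendsto_intros) (simp add: filterlim_ident)
  then show ?thesis
    using assms by (auto simp: tendsto_def)
qed

lemma has_pd_cong:
  assumes "open S" "x \<in> S" "\<And>y. y \<in> S \<Longrightarrow> f y = g y"
  shows "has_pd i f D x \<longleftrightarrow> has_pd i g D x"
  unfolding has_pd_def
proof (rule DERIV_cong_ev)
  show "\<forall>\<^sub>F t in nhds 0. f (x + t *\<^sub>R axis i 1) = g (x + t *\<^sub>R axis i 1)"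
    using eventually_line[OF assms(1,2)] by eventually_elim (rule assms(3))
qed auto

lemma partial_cong:
  assumes "open S" "x \<in> S" "\<And>y. y \<in> S \<Longrightarrow> f y = g y"
  shows "partial i f x = partial i g x"
  unfolding partial_def
proof (rule deriv_cong_ev)
  show "\<forall>\<^sub>F t in nhds 0. f (x + t *\<^sub>R axis i 1) = g (x + t *\<^sub>R axis i 1)"
    using eventually_line[OF assms(1,2)] by eventually_elim (rule assms(3))
qed auto

lemma has_partial_at_cong:
  assumes "open S" "x \<in> S" "\<And>y. y \<in> S \<Longrightarrow> f y = g y" "has_partial_at i f x"
  shows "has_partial_at i g x"
  by (rule has_pdD(1)[OF iffD1[OF has_pd_cong[OF assms(1-3)] has_pd_partial[OF assms(4)]]])

text \<open>Openness of \<open>S\<close> is what makes this true: \<open>partial\<close> looks along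
  lines, and an open set contains a segment around each of its points on every such line.\<close>

lemma C_on_cong:
  assumes "open S" "\<And>y. y \<in> S \<Longrightarrow> f y = g y" "C_on k f S"
  shows "C_on k g S"
  using assms(2,3)
proof (induction k arbitrary: f g)
  case 0
  then show ?case by (simp cong: continuous_on_cong)
next
  case (Suc k)
  have "C_on k (partial i g) S" for i
    by (rule Suc.IH[of "partial i f"])
       (use Suc.prems in \<open>auto intro: partial_cong[OF assms(1)]\<close>)
  moreover have "has_partial_at i g x" if "x \<in> S" for x i
    using has_partial_at_cong[OF assms(1) that, of f g] Suc.prems that by auto
  moreover have "continuous_on S g"
    using Suc.prems by (auto cong: continuous_on_cong)
  ultimately show ?case by simp
qed

lemma C_on_continuous: "C_on k f S \<Longrightarrow> continuous_on S f"
  by (cases k) auto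

lemma C_on_subset: "C_on k f S \<Longrightarrow> T \<subseteq> S \<Longrightarrow> C_on k f T"
  by (induction k arbitrary: f) (auto intro: continuous_on_subset)

lemma C_on_Suc_imp: "C_on (Suc k) f S \<Longrightarrow> C_on k f S"
  by (induction k arbitrary: f) auto

lemma C_on_le: "C_on k f S \<Longrightarrow> j \<le> k \<Longrightarrow> C_on j f S"
  by (induction k) (auto simp del: C_on.simps simp: le_Suc_eq dest: C_on_Suc_imp)

lemma C_on_partial: "C_on (Suc k) f S \<Longrightarrow> C_on k (partial i f) S"
  by simp

lemma C_on_has_pd: "C_on (Suc k) f S \<Longrightarrow> x \<in> S \<Longrightarrow> has_pd i f (partial i f x) x"
  by (intro has_pd_partial) simp

text \<open>The working introduction rule. The candidates \<open>f'\<close> have to match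
  \<open>partial i f\<close> only on \<open>S\<close>; outside, \<open>deriv\<close> may return
  arbitrary values, and \<open>C_on_cong\<close> bridges the gap.\<close>

lemma C_on_SucI:
  assumes "open S" "continuous_on S f"
    and "\<And>i x. x \<in> S \<Longrightarrow> has_pd i f (f' i x) x" "\<And>i. C_on k (f' i) S"
  shows "C_on (Suc k) f S"
  using assms has_pdD[OF assms(3)] by (auto intro: C_on_cong[OF assms(1) _ assms(4)])

section \<open>Closure of the classes under algebra, gluing and dilation\<close>

lemma has_pd_add: "has_pd i f D x \<Longrightarrow> has_pd i g E x \<Longrightarrow> has_pd i (\<lambda>y. f y + g y) (D + E) x"
  unfolding has_pd_def by (rule DERIV_add)

lemma has_pd_minus: "has_pd i f D x \<Longrightarrow> has_pd i (\<lambda>y. - f y) (- D) x"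
  unfolding has_pd_def by (rule DERIV_minus)

lemma has_pd_mult:
  assumes "has_pd i f D x" "has_pd i g E x"
  shows "has_pd i (\<lambda>y. f y * g y) (D * g x + f x * E) x"
  using DERIV_mult[OF assms[unfolded has_pd_def]] by (simp add: has_pd_def algebra_simps)

lemma has_pd_const: "has_pd i (\<lambda>y. c) 0 x"
  by (simp add: has_pd_def)

lemma C_on_const: "open S \<Longrightarrow> C_on k (\<lambda>x. c) S"
proof (induction k arbitrary: c)
  case (Suc k)
  then show ?case by (intro C_on_SucI[where f' = "\<lambda>i x. 0"]) (auto intro: has_pd_const)
qed auto

lemma C_on_add: "open S \<Longrightarrow> C_on k f S \<Longrightarrow> C_on k g S \<Longrightarrow> C_on k (\<lambda>x. f x + g x) S"
proof (induction k arbitrary: f g)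
  case (Suc k)
  show ?case
    using Suc.prems C_on_has_pd
    by (intro C_on_SucI[where f' = "\<lambda>i x. partial i f x + partial i g x"])
       (auto intro!: Suc.IH has_pd_add has_pd_partial continuous_on_add)
qed (auto intro: continuous_on_add continuous_on_minus continuous_on_mult)

lemma C_on_minus: "open S \<Longrightarrow> C_on k f S \<Longrightarrow> C_on k (\<lambda>x. - f x) S"
proof (induction k arbitrary: f)
  case (Suc k)
  show ?case
    using Suc.prems
    by (intro C_on_SucI[where f' = "\<lambda>i x. - partial i f x"])
       (auto intro!: Suc.IH has_pd_minus has_pd_partial continuous_on_minus)
qed (auto intro: continuous_on_add continuous_on_minus continuous_on_mult)

lemma C_on_diff: "open S \<Longrightarrow> C_on k f S \<Longrightarrow> C_on k g S \<Longrightarrow> C_on k (\<lambda>x. f x - g x) S"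
  using C_on_add[of S k f "\<lambda>x. - g x"] C_on_minus[of S k g] by simp

lemma C_on_mult: "open S \<Longrightarrow> C_on k f S \<Longrightarrow> C_on k g S \<Longrightarrow> C_on k (\<lambda>x. f x * g x) S"
proof (induction k arbitrary: f g)
  case (Suc k)
  have le: "C_on k f S" "C_on k g S"
    using Suc.prems C_on_Suc_imp by blast+
  show ?case
    using Suc.prems le
    by (intro C_on_SucI[where f' = "\<lambda>i x. partial i f x * g x + f x * partial i g x"])
       (auto intro!: Suc.IH C_on_add has_pd_mult has_pd_partial continuous_on_mult)
qed (auto intro: continuous_on_add continuous_on_minus continuous_on_mult)

lemma C_on_sum:
  assumes "open S" "\<And>i. i \<in> I \<Longrightarrow> C_on k (f i) S"
  shows "C_on k (\<lambda>x. \<Sum>i\<in>I. f i x) S"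
  using assms
  by (induction I rule: infinite_finite_induct) (auto intro!: C_on_add C_on_const)

text \<open>Continuity and partial derivatives are local on open sets. This is used to extend a
  product by zero across the place where one factor is singular and the other vanishes.\<close>

lemma C_on_Un:
  assumes "open S" "open T"
  shows "C_on k f S \<Longrightarrow> C_on k f T \<Longrightarrow> C_on k f (S \<union> T)"
  by (induction k arbitrary: f) (use assms in \<open>auto intro: continuous_on_open_Un\<close>)

lemma C_on_zero: "open S \<Longrightarrow> (\<And>x. x \<in> S \<Longrightarrow> f x = 0) \<Longrightarrow> C_on k f S"
  by (rule C_on_cong[OF _ _ C_on_const[of S k 0]]) auto

lemma C_on_component: "C_on k (\<lambda>x. x $ j) UNIV"
proof (cases k)
  case (Suc k)
  have "has_pd i (\<lambda>x. x $ j) (axis i 1 $ j) x" for i and x :: "real ^ 'a"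
    unfolding has_pd_def by (auto intro!: derivative_eq_intros)
  then show ?thesis
    unfolding Suc by (intro C_on_SucI[where f' = "\<lambda>i x. axis i 1 $ j"])
       (auto intro!: C_on_const continuous_on_component)
qed (auto intro: continuous_on_component)

lemma C_on_norm_square: "C_on k (\<lambda>x :: real ^ 'n::finite. (norm x)\<^sup>2) UNIV"
proof -
  have "(\<lambda>x :: real ^ 'n. (norm x)\<^sup>2) = (\<lambda>x. \<Sum>j\<in>UNIV. x $ j * x $ j)"
    by (simp add: fun_eq_iff power2_norm_eq_inner inner_vec_def)
  then show ?thesis
    by (simp add: C_on_sum C_on_mult C_on_component)
qed

lemma has_pd_scale:
  assumes "has_pd i f D (c *\<^sub>R x)"
  shows "has_pd i (\<lambda>y. f (c *\<^sub>R y)) (c * D) x"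
proof -
  have "((\<lambda>t. f (c *\<^sub>R x + t *\<^sub>R axis i 1)) has_real_derivative D) (at (c * 0))"
    using assms by (simp add: has_pd_def)
  from DERIV_chain2[where f = "\<lambda>t. f (c *\<^sub>R x + t *\<^sub>R axis i 1)" and g = "\<lambda>t. c * t" and x = 0
      and s = UNIV and Db = c, OF this]
  have "((\<lambda>t. f (c *\<^sub>R x + (c * t) *\<^sub>R axis i 1)) has_real_derivative D * c) (at 0)"
    by (auto intro!: derivative_eq_intros)
  then show ?thesis by (simp add: has_pd_def algebra_simps)
qed

lemma C_on_scale:
  "C_on k f UNIV \<Longrightarrow> C_on k (\<lambda>x. f (c *\<^sub>R x)) UNIV"
proof (induction k arbitrary: f)
  case 0
  then show ?case
    by (auto intro!: continuous_on_compose2[of UNIV f] continuous_intros)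
next
  case (Suc k)
  have "C_on k (\<lambda>x. c * partial i f (c *\<^sub>R x)) UNIV" for i
    using Suc by (intro C_on_mult C_on_const) auto
  moreover have "continuous_on UNIV (\<lambda>x. f (c *\<^sub>R x))"
    by (rule continuous_on_compose2[OF C_on_continuous[OF Suc.prems]]) (auto intro: continuous_intros)
  ultimately show ?case
    using Suc.prems
    by (intro C_on_SucI[where f' = "\<lambda>i x. c * partial i f (c *\<^sub>R x)"])
       (auto intro!: has_pd_scale has_pd_partial)
qed

lemma partial_scale:
  "C_on (Suc 0) f UNIV \<Longrightarrow> partial i (\<lambda>x. f (c *\<^sub>R x)) = (\<lambda>x. c * partial i f (c *\<^sub>R x))"
  by (rule ext, rule has_pdD(2), rule has_pd_scale, erule C_on_has_pd) simp


section \<open>Powers of the Laplacian of truncated polynomials\<close>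

text \<open>The truncated power of \<open>P\<close>: across the zero set of \<open>P\<close> its
  regularity grows with \<open>k\<close>, so compactly supported test functions arise from
  polynomials.\<close>

definition pos_pow :: "nat \<Rightarrow> (real ^ 'n::finite \<Rightarrow> real) \<Rightarrow> real ^ 'n \<Rightarrow> real" where
  "pos_pow k P x = (max 0 (P x)) ^ k"

text \<open>Only the kink matters: at 0 the difference quotient is \<open>(max 0 h) ^ Suc k\<close>,
  which tends to 0 because a positive exponent is left over.\<close>

lemma DERIV_max_power:
  "((\<lambda>s::real. (max 0 s) ^ Suc (Suc k)) has_real_derivative real (Suc (Suc k)) * (max 0 s) ^ Suc k) (at s)"
proof -
  consider "s > 0" | "s < 0" | "s = 0" by linarith
  then show ?thesis
  proof cases
    case 1
    have "\<forall>\<^sub>F t in nhds s. (max 0 t) ^ Suc (Suc k) = t ^ Suc (Suc k)"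
      using eventually_nhds_in_open[of "{0<..}" s] 1 by (auto elim!: eventually_mono)
    from DERIV_cong_ev[OF refl this refl] show ?thesis
      using 1 DERIV_pow[of "Suc (Suc k)" s] by (simp add: max_def)
  next
    case 2
    have "\<forall>\<^sub>F t in nhds s. (max 0 t) ^ Suc (Suc k) = 0"
      using eventually_nhds_in_open[of "{..<0}" s] 2 by (auto elim!: eventually_mono)
    from DERIV_cong_ev[OF refl this refl] show ?thesis
      using 2 by simp
  next
    case 3
    have "((\<lambda>h. (max 0 h) ^ Suc k) \<longlongrightarrow> (max 0 0) ^ Suc k) (at (0::real))"
      by (intro tendsto_intros)
    moreover have "(max 0 h) ^ Suc (Suc k) / h = (max 0 h) ^ Suc k" for h :: real
      by (cases "h > 0") (auto simp: max_def field_simps)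
    ultimately show ?thesis
      unfolding 3 DERIV_def by simp
  qed
qed

lemma has_pd_pos_pow:
  assumes "has_pd i P D x"
  shows "has_pd i (pos_pow (Suc (Suc k)) P) (real (Suc (Suc k)) * pos_pow (Suc k) P x * D) x"
proof -
  have "((\<lambda>s. (max 0 s) ^ Suc (Suc k)) has_real_derivative real (Suc (Suc k)) * (max 0 (P x)) ^ Suc k)
      (at (P (x + 0 *\<^sub>R axis i 1)))"
    using DERIV_max_power[of k "P x"] by simp
  from DERIV_chain2[OF this assms[unfolded has_pd_def]] show ?thesis
    by (simp add: has_pd_def pos_pow_def)
qed

lemma continuous_on_pos_pow: "continuous_on S P \<Longrightarrow> continuous_on S (pos_pow k P)"
  unfolding pos_pow_def by (intro continuous_on_power continuous_on_max continuous_on_const)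

lemma C_on_pos_pow:
  assumes "open S" "C_on k P S"
  shows "C_on k (pos_pow (Suc k) P) S"
  using assms(2)
proof (induction k)
  case 0
  then show ?case by (simp add: continuous_on_pos_pow)
next
  case (Suc k)
  then have IH: "C_on k (pos_pow (Suc k) P) S"
    using C_on_Suc_imp by blast
  show ?case
    by (rule C_on_SucI[OF assms(1) continuous_on_pos_pow has_pd_pos_pow])
       (use Suc.prems assms(1) IH in \<open>auto intro!: C_on_mult C_on_const has_pd_partial\<close>)
qed

text \<open>One derivative costs one power. The term in which \<open>F\<close> is differentiated has
  a power to spare, and the spare factor is moved into the smooth coefficient.\<close>

lemma partial_mult_pos_pow:
  assumes F: "\<And>k. C_on k F UNIV" and P: "\<And>k. C_on k P UNIV"
  shows "\<exists>F'. (\<forall>k. C_on k F' UNIV) \<and>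
    partial i (\<lambda>x. F x * pos_pow (Suc (Suc j)) P x) = (\<lambda>x. F' x * pos_pow (Suc j) P x)"
proof (intro exI conjI allI)
  let ?F' = "\<lambda>x. partial i F x * P x + real (Suc (Suc j)) * (F x * partial i P x)"
  show "C_on k ?F' UNIV" for k
    by (intro C_on_add C_on_mult C_on_const C_on_partial F P open_UNIV)
  have "has_pd i (\<lambda>x. F x * pos_pow (Suc (Suc j)) P x) (?F' x * pos_pow (Suc j) P x) x" for x
  proof -
    have "has_pd i (\<lambda>x. F x * pos_pow (Suc (Suc j)) P x)
      (partial i F x * pos_pow (Suc (Suc j)) P x
        + F x * (real (Suc (Suc j)) * pos_pow (Suc j) P x * partial i P x)) x"
      by (intro has_pd_mult has_pd_pos_pow C_on_has_pd[OF F] C_on_has_pd[OF P]) auto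
    \<comment> \<open>The untruncated \<open>P x\<close> can be split off, since the remaining power
      is positive and vanishes wherever \<open>P x\<close> is negative. This keeps the new
      coefficient smooth.\<close>
    moreover have "pos_pow (Suc (Suc j)) P x = P x * pos_pow (Suc j) P x"
      by (auto simp: pos_pow_def max_def)
    ultimately show ?thesis
      by (simp add: algebra_simps)
  qed
  then show "partial i (\<lambda>x. F x * pos_pow (Suc (Suc j)) P x) = (\<lambda>x. ?F' x * pos_pow (Suc j) P x)"
    using has_pdD(2) by blast
qed

lemma laplacian_mult_pos_pow:
  assumes F: "\<And>k. C_on k F UNIV" and P: "\<And>k. C_on k P UNIV"
  shows "\<exists>F'. (\<forall>k. C_on k F' UNIV) \<and>
    laplacian (\<lambda>x. F x * pos_pow (Suc (Suc (Suc j))) P x) = (\<lambda>x. F' x * pos_pow (Suc j) P x)"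
proof -
  have "\<exists>G. (\<forall>k. C_on k G UNIV) \<and> partial i (partial i (\<lambda>x. F x * pos_pow (Suc (Suc (Suc j))) P x))
      = (\<lambda>x. G x * pos_pow (Suc j) P x)" for i
  proof -
    obtain G1 where G1: "\<And>k. C_on k G1 UNIV"
      "partial i (\<lambda>x. F x * pos_pow (Suc (Suc (Suc j))) P x) = (\<lambda>x. G1 x * pos_pow (Suc (Suc j)) P x)"
      using partial_mult_pos_pow[OF F P, where j = "Suc j" and i = i] by auto
    obtain G2 where "\<And>k. C_on k G2 UNIV"
      "partial i (\<lambda>x. G1 x * pos_pow (Suc (Suc j)) P x) = (\<lambda>x. G2 x * pos_pow (Suc j) P x)"
      using partial_mult_pos_pow[OF G1(1) P, where j = j and i = i] by auto
    with G1(2) show ?thesis by auto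
  qed
  then obtain G where G: "\<And>i k. C_on k (G i) UNIV"
    "\<And>i. partial i (partial i (\<lambda>x. F x * pos_pow (Suc (Suc (Suc j))) P x)) = (\<lambda>x. G i x * pos_pow (Suc j) P x)"
    by metis
  show ?thesis
  proof (intro exI conjI allI)
    show "C_on k (\<lambda>x. \<Sum>i\<in>UNIV. G i x) UNIV" for k
      by (intro C_on_sum G open_UNIV)
    show "laplacian (\<lambda>x. F x * pos_pow (Suc (Suc (Suc j))) P x)
        = (\<lambda>x. (\<Sum>i\<in>UNIV. G i x) * pos_pow (Suc j) P x)"
      by (simp add: fun_eq_iff laplacian_def G(2) sum_distrib_right)
  qed
qed

section \<open>Iterated Laplacians: order counting and scaling\<close>

lemma neg_laplacian_pow_Suc: "neg_laplacian_pow (Suc m) f = neg_laplacian_pow m (\<lambda>x. - laplacian f x)"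
  by (simp add: neg_laplacian_pow_def funpow_Suc_right del: funpow.simps)

lemma neg_laplacian_pow_Suc': "neg_laplacian_pow (Suc m) f x = - laplacian (neg_laplacian_pow m f) x"
  by (simp add: neg_laplacian_pow_def)

lemma neg_laplacian_pow_0: "neg_laplacian_pow 0 f = f"
  by (simp add: neg_laplacian_pow_def)

text \<open>Each Laplacian uses up two powers, so 2m of them disappear. The coefficient is
  differentiated anew at every stage, which is why it has to be smooth of every order.\<close>

lemma neg_laplacian_pow_mult_pos_pow:
  assumes F: "\<And>k. C_on k F UNIV" and P: "\<And>k. C_on k P UNIV"
  shows "\<exists>F'. (\<forall>k. C_on k F' UNIV) \<and>
    neg_laplacian_pow m (\<lambda>x. F x * pos_pow (2 * m + Suc j) P x) = (\<lambda>x. F' x * pos_pow (Suc j) P x)"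
  using F
proof (induction m arbitrary: F)
  case 0
  then show ?case by (auto simp: neg_laplacian_pow_0)
next
  case (Suc m)
  obtain G where G: "\<And>k. C_on k G UNIV"
    "laplacian (\<lambda>x. F x * pos_pow (Suc (Suc (Suc (2 * m + j)))) P x) = (\<lambda>x. G x * pos_pow (Suc (2 * m + j)) P x)"
    using laplacian_mult_pos_pow[OF Suc.prems P, where j = "2 * m + j"] by auto
  have "\<And>k. C_on k (\<lambda>x. - G x) UNIV"
    by (intro C_on_minus G open_UNIV)
  from Suc.IH[OF this] show ?case
    using G(2) by (simp add: neg_laplacian_pow_Suc)
qed

lemma C_on_laplacian: "open S \<Longrightarrow> C_on (Suc (Suc k)) f S \<Longrightarrow> C_on k (laplacian f) S"
  unfolding laplacian_def[abs_def] by (intro C_on_sum C_on_partial) auto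

lemma C_on_neg_laplacian_pow:
  assumes "open S" "C_on (k + 2 * m) f S"
  shows "C_on k (neg_laplacian_pow m f) S"
  using assms(2)
proof (induction m arbitrary: f)
  case (Suc m)
  have "C_on (k + 2 * m) (\<lambda>x. - laplacian f x) S"
    using Suc.prems assms(1) by (intro C_on_minus C_on_laplacian) auto
  then show ?case
    unfolding neg_laplacian_pow_Suc by (rule Suc.IH)
qed (simp add: neg_laplacian_pow_0)

lemma laplacian_cmult:
  assumes "C_on 2 f UNIV"
  shows "laplacian (\<lambda>x. c * f x) x = c * laplacian f x"
proof -
  have f: "C_on (Suc (Suc 0)) f UNIV"
    using assms by (simp add: numeral_2_eq_2)
  have *: "partial i (\<lambda>x. c * g x) x = c * partial i g x" if "C_on (Suc 0) g UNIV" for i x and g :: "real ^ 'a \<Rightarrow> real"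
    using has_pdD(2)[OF has_pd_mult[OF has_pd_const C_on_has_pd[OF that]]] by simp
  have "partial i (\<lambda>x. c * f x) = (\<lambda>x. c * partial i f x)" for i
    using *[OF C_on_Suc_imp[OF f]] by blast
  then have "partial i (partial i (\<lambda>x. c * f x)) x = c * partial i (partial i f) x" for i
    using *[OF C_on_partial[OF f]] by simp
  then show ?thesis
    by (simp add: laplacian_def sum_distrib_left)
qed

lemma laplacian_scale:
  assumes "C_on 2 f UNIV"
  shows "laplacian (\<lambda>x. f (c *\<^sub>R x)) x = c\<^sup>2 * laplacian f (c *\<^sub>R x)"
proof -
  have f: "C_on (Suc (Suc 0)) f UNIV"
    using assms by (simp add: numeral_2_eq_2)
  have "partial i (partial i (\<lambda>x. f (c *\<^sub>R x))) x = c\<^sup>2 * partial i (partial i f) (c *\<^sub>R x)" for i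
  proof -
    have "partial i (\<lambda>x. f (c *\<^sub>R x)) = (\<lambda>x. c * partial i f (c *\<^sub>R x))"
      by (rule partial_scale[OF C_on_Suc_imp[OF f]])
    moreover have "has_pd i (\<lambda>x. c * partial i f (c *\<^sub>R x)) (0 * partial i f (c *\<^sub>R x) + c * (c * partial i (partial i f) (c *\<^sub>R x))) x"
      by (intro has_pd_mult has_pd_const has_pd_scale C_on_has_pd[OF C_on_partial[OF f]]) auto
    ultimately show ?thesis
      using has_pdD(2) by (fastforce simp: power2_eq_square)
  qed
  then show ?thesis
    by (simp add: laplacian_def sum_distrib_left)
qed

lemma neg_laplacian_pow_scale:
  assumes "C_on (2 * m) f UNIV"
  shows "neg_laplacian_pow m (\<lambda>x. f (c *\<^sub>R x)) x = c ^ (2 * m) * neg_laplacian_pow m f (c *\<^sub>R x)"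
  using assms
proof (induction m arbitrary: x)
  case (Suc m)
  let ?g = "neg_laplacian_pow m f"
  have g: "C_on 2 ?g UNIV"
    using Suc.prems by (intro C_on_neg_laplacian_pow) (auto simp: numeral_2_eq_2 simp del: C_on.simps)
  have "neg_laplacian_pow m (\<lambda>x. f (c *\<^sub>R x)) = (\<lambda>x. c ^ (2 * m) * ?g (c *\<^sub>R x))"
    using Suc.IH C_on_le[OF Suc.prems] by auto
  moreover have "laplacian (\<lambda>x. c ^ (2 * m) * ?g (c *\<^sub>R x)) x = c ^ (2 * m) * laplacian (\<lambda>x. ?g (c *\<^sub>R x)) x"
    by (rule laplacian_cmult) (rule C_on_scale[OF g])
  ultimately show ?case
    by (simp add: neg_laplacian_pow_Suc' laplacian_scale[OF g] power_add power2_eq_square)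
qed (simp add: neg_laplacian_pow_0)

section \<open>Integration by parts\<close>

lemma integrable_compact_support:
  fixes f :: "'a::euclidean_space \<Rightarrow> real"
  assumes "continuous_on UNIV f" "\<And>x. norm x > R \<Longrightarrow> f x = 0"
  shows "integrable lborel f"
proof -
  have "integrable lborel (\<lambda>x. indicator (cball 0 R) x *\<^sub>R f x)"
    by (intro borel_integrable_compact compact_cball continuous_on_subset[OF assms(1)]) simp
  moreover have "(\<lambda>x. indicator (cball 0 R) x *\<^sub>R f x) = f"
    using assms(2) by (auto simp: indicator_def fun_eq_iff not_le)
  ultimately show ?thesis by simp
qed

lemma bounded_compact_support:
  fixes f :: "'a::euclidean_space \<Rightarrow> real"
  assumes "continuous_on UNIV f" "\<And>x. norm x > R \<Longrightarrow> f x = 0"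
  shows "\<exists>B\<ge>0. \<forall>x. \<bar>f x\<bar> \<le> B"
proof -
  have "bounded (f ` cball 0 R)"
    by (intro compact_imp_bounded compact_continuous_image continuous_on_subset[OF assms(1)]) auto
  then obtain B where B: "\<And>x. norm x \<le> R \<Longrightarrow> \<bar>f x\<bar> \<le> B"
    by (auto simp: bounded_iff) (meson mem_cball_0)
  have "\<bar>f x\<bar> \<le> max 0 B" for x
    using B[of x] assms(2)[of x] by (cases "norm x \<le> R") auto
  then show ?thesis by (intro exI[of _ "max 0 B"]) auto
qed

lemma integral_bound_cball:
  fixes f :: "'a::euclidean_space \<Rightarrow> real"
  assumes "integrable lborel f" "\<And>x. \<bar>f x\<bar> \<le> c" "\<And>x. norm x > r \<Longrightarrow> f x = 0" "r \<ge> 0"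
  shows "\<bar>integral\<^sup>L lborel f\<bar> \<le> c * unit_ball_vol (real DIM('a)) * r ^ DIM('a)"
proof -
  have fin: "emeasure lborel (cball (0::'a) r) < \<infinity>"
    using emeasure_compact_finite[of "cball (0::'a) r"] by (simp add: less_top)
  have "\<bar>integral\<^sup>L lborel f\<bar> \<le> (\<integral>x. \<bar>f x\<bar> \<partial>lborel)"
    by (rule integral_abs_bound)
  also have "\<dots> \<le> (\<integral>x. c * indicator (cball (0::'a) r) x \<partial>lborel)"
  proof (rule Bochner_Integration.integral_mono)
    show "integrable lborel (\<lambda>x. c * indicator (cball (0::'a) r) x)"
      using fin by simp
    show "\<bar>f x\<bar> \<le> c * indicator (cball 0 r) x" for x
      using assms(2)[of x] assms(3)[of x] by (auto simp: indicator_def not_le)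
  qed (use assms(1) in simp)
  also have "\<dots> = c * measure lborel (cball (0::'a) r)"
    by simp
  also have "measure lborel (cball (0::'a) r) = unit_ball_vol (real DIM('a)) * r ^ DIM('a)"
    using assms(4) by (simp add: content_cball)
  finally show ?thesis by (simp add: mult.assoc)
qed

section \<open>Vanishing of derivatives off the support, and Green's identity\<close>

lemma partial_zero:
  assumes "open T" "\<And>x. x \<in> T \<Longrightarrow> f x = 0" "x \<in> T"
  shows "partial i f x = 0"
  using partial_cong[OF assms(1,3), of f "\<lambda>x. 0"] assms(2) has_pdD(2)[OF has_pd_const] by metis

lemma open_norm_greater: "open {x::'a::real_normed_vector. norm x > R}"
  by (intro open_Collect_less continuous_intros)

lemma partial_zero_norm_greater:
  assumes "\<And>x. norm x > R \<Longrightarrow> f x = 0" "norm x > R"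
  shows "partial i f x = 0"
  by (rule partial_zero[OF open_norm_greater[of R]]) (use assms in auto)

lemma laplacian_zero:
  assumes "open T" "\<And>x. x \<in> T \<Longrightarrow> f x = 0" "x \<in> T"
  shows "laplacian f x = 0"
proof -
  have "partial i f y = 0" if "y \<in> T" for i y
    by (rule partial_zero[OF assms(1,2) that])
  from partial_zero[OF assms(1) this assms(3)] show ?thesis
    by (simp add: laplacian_def)
qed

lemma neg_laplacian_pow_zero:
  assumes "open T" "\<And>x. x \<in> T \<Longrightarrow> f x = 0" "x \<in> T"
  shows "neg_laplacian_pow m f x = 0"
  using assms(3)
proof (induction m arbitrary: x)
  case (Suc m)
  then show ?case
    using laplacian_zero[OF assms(1), of "neg_laplacian_pow m f" x] by (simp add: neg_laplacian_pow_Suc')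
qed (simp add: neg_laplacian_pow_0 assms(2))

text \<open>By translation invariance the difference quotients of \<open>g\<close> have integral zero, and they converge
  dominatedly to the partial derivative.\<close>

lemma integral_partial_eq_0:
  fixes g :: "real ^ 'n::finite \<Rightarrow> real"
  assumes g: "C_on (Suc 0) g UNIV" and supp: "\<And>x. norm x > R \<Longrightarrow> g x = 0"
  shows "integral\<^sup>L lborel (partial i g) = 0"
proof -
  define e :: "real ^ 'n" where "e = axis i 1"
  have [simp]: "norm e = 1" by (simp add: e_def)
  have cont: "continuous_on UNIV g" "continuous_on UNIV (partial i g)"
    using g by auto
  then have [measurable]: "g \<in> borel_measurable borel" "partial i g \<in> borel_measurable borel"
    by (auto intro: borel_measurable_continuous_onI)
  have supp': "partial i g x = 0" if "norm x > R" for x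
    by (rule partial_zero_norm_greater[OF supp that])
  obtain B where B: "B \<ge> 0" "\<And>x. \<bar>partial i g x\<bar> \<le> B"
    using bounded_compact_support[OF cont(2) supp'] by auto
  define h :: "nat \<Rightarrow> real" where "h n = inverse (real (Suc n))" for n
  have h: "h n > 0" "h n \<le> 1" for n
    by (auto simp: h_def field_simps)
  define q where "q n x = (g (x + h n *\<^sub>R e) - g x) / h n" for n x
  have deriv: "((\<lambda>t. g (x + t *\<^sub>R e)) has_real_derivative partial i g (x + t *\<^sub>R e)) (at t)" for x t
  proof -
    have "((\<lambda>s. g ((x + t *\<^sub>R e) + s *\<^sub>R e)) has_real_derivative partial i g (x + t *\<^sub>R e)) (at 0)"
      using C_on_has_pd[OF g, of "x + t *\<^sub>R e" i] by (simp add: has_pd_def e_def)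
    moreover have "(\<lambda>s. g ((x + t *\<^sub>R e) + s *\<^sub>R e)) = (\<lambda>s. g (x + (s + t) *\<^sub>R e))"
      by (simp add: algebra_simps)
    ultimately show ?thesis
      using DERIV_shift[of "\<lambda>t. g (x + t *\<^sub>R e)" "partial i g (x + t *\<^sub>R e)" 0 t] by simp
  qed
  have int_g: "integrable lborel g"
    by (rule integrable_compact_support[OF cont(1) supp])
  have shift: "integrable lborel (\<lambda>x. g (x + c))" "(\<integral>x. g (x + c) \<partial>lborel) = integral\<^sup>L lborel g" for c
  proof -
    have "integrable (distr lborel borel ((+) c)) g"
      using int_g by (simp add: lborel_distr_plus)
    then show "integrable lborel (\<lambda>x. g (x + c))"
      by (subst (asm) integrable_distr_eq) (auto simp: add.commute)
    have "integral\<^sup>L (distr lborel borel ((+) c)) g = integral\<^sup>L lborel g"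
      by (simp add: lborel_distr_plus)
    then show "(\<integral>x. g (x + c) \<partial>lborel) = integral\<^sup>L lborel g"
      by (subst (asm) integral_distr) (auto simp: add.commute)
  qed
  have "integral\<^sup>L lborel (q n) = 0" for n
    using shift[of "h n *\<^sub>R e"] int_g by (simp add: q_def[abs_def])
  moreover have "(\<lambda>n. integral\<^sup>L lborel (q n)) \<longlonglongrightarrow> integral\<^sup>L lborel (partial i g)"
  \<comment> \<open>All steps satisfy \<open>h n \<le> 1\<close>, so the difference quotients live
    in the ball of radius \<open>R + 1\<close>; the mean value theorem bounds them by
    \<open>B\<close> there.\<close>
  proof (rule integral_dominated_convergence[where w = "\<lambda>x. B * indicator (cball 0 (R + 1)) x"])
    show "integrable lborel (\<lambda>x::real ^ 'n. B * indicator (cball 0 (R + 1)) x)"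
      using emeasure_compact_finite[of "cball (0::real ^ 'n) (R + 1)"] by (simp add: less_top)
    have "(\<lambda>n. q n x) \<longlonglongrightarrow> partial i g x" for x
    proof -
      have "((\<lambda>t. (g (x + t *\<^sub>R e) - g x) / t) \<longlongrightarrow> partial i g x) (at 0)"
        using deriv[of x 0] by (simp add: DERIV_def)
      moreover have "filterlim h (at 0) sequentially"
        unfolding h_def using LIMSEQ_inverse_real_of_nat by (auto simp: filterlim_at)
      ultimately show ?thesis
        unfolding q_def by (rule filterlim_compose)
    qed
    then show "AE x in lborel. (\<lambda>n. q n x) \<longlonglongrightarrow> partial i g x" by simp
    have "\<bar>q n x\<bar> \<le> B * indicator (cball 0 (R + 1)) x" for n x
    proof (cases "norm x \<le> R + 1")
      case True
      from MVT2[OF h(1)[of n], of "\<lambda>t. g (x + t *\<^sub>R e)" "\<lambda>t. partial i g (x + t *\<^sub>R e)"] deriv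
      obtain t where "g (x + h n *\<^sub>R e) - g x = h n * partial i g (x + t *\<^sub>R e)"
        by auto
      then have "q n x = partial i g (x + t *\<^sub>R e)"
        using h(1)[of n] by (simp add: q_def)
      then show ?thesis using B True by simp
    next
      case False
      have "norm x - norm (h n *\<^sub>R e) \<le> norm (x + h n *\<^sub>R e)"
        by (rule norm_diff_ineq)
      then have "norm (x + h n *\<^sub>R e) > R"
        using False h[of n] by simp
      then have "q n x = 0"
        using False by (simp add: q_def supp)
      then show ?thesis using B(1) by simp
    qed
    then show "\<And>n. AE x in lborel. norm (q n x) \<le> B * indicator (cball 0 (R + 1)) x" by simp
  qed (simp_all add: q_def[abs_def])
  ultimately show ?thesis
    by (simp add: LIMSEQ_const_iff)
qed

text \<open>The second open set \<open>T\<close> allows \<open>v\<close> to be singular off the support of \<open>\<phi>\<close>.\<close>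

lemma Green_identity:
  fixes v \<phi> :: "real ^ 'n::finite \<Rightarrow> real"
  assumes ST: "open S" "open T" "S \<union> T = UNIV"
    and v: "C_on 2 v S" and \<phi>: "C_on 2 \<phi> UNIV"
    and zero: "\<And>x. x \<in> T \<Longrightarrow> \<phi> x = 0" and supp: "\<And>x. norm x > R \<Longrightarrow> \<phi> x = 0"
  shows "integrable lborel (\<lambda>x. \<phi> x * laplacian v x)" "integrable lborel (\<lambda>x. v x * laplacian \<phi> x)"
    and "(\<integral>x. \<phi> x * laplacian v x \<partial>lborel) = (\<integral>x. v x * laplacian \<phi> x \<partial>lborel)"
proof -
  have v': "C_on (Suc (Suc 0)) v S" and \<phi>': "C_on (Suc (Suc 0)) \<phi> UNIV"
    using v \<phi> by (simp_all add: numeral_2_eq_2)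
  have \<phi>S: "C_on (Suc (Suc 0)) \<phi> S"
    using \<phi>' by (rule C_on_subset) simp
  \<comment> \<open>Every function below has \<phi> or one of its derivatives in each term, so it
    vanishes on \<open>T\<close> whatever \<open>v\<close> does there.\<close>
  have glue: "C_on k f UNIV" if "C_on k f S" "\<And>x. x \<in> T \<Longrightarrow> f x = 0" for k f
    using C_on_Un[OF ST(1,2) that(1) C_on_zero[OF ST(2) that(2)]] ST(3) by simp
  have zero1: "partial i \<phi> x = 0" if "x \<in> T" for i x
    by (rule partial_zero[OF ST(2) zero that])
  have zero2: "partial i (partial i \<phi>) x = 0" if "x \<in> T" for i x
    by (rule partial_zero[OF ST(2) zero1 that])
  have supp1: "partial i \<phi> x = 0" if "norm x > R" for i x
    by (rule partial_zero_norm_greater[OF supp that])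
  have supp2: "partial i (partial i \<phi>) x = 0" if "norm x > R" for i x
    by (rule partial_zero_norm_greater[OF supp1 that])
  have "C_on 0 (\<lambda>x. \<phi> x * laplacian v x) UNIV"
    by (rule glue, intro C_on_mult C_on_laplacian ST C_on_le[OF \<phi>S] v') (simp_all add: zero)
  then show int1: "integrable lborel (\<lambda>x. \<phi> x * laplacian v x)"
    by (intro integrable_compact_support[of _ R]) (simp_all add: supp)
  have "C_on 0 (\<lambda>x. v x * laplacian \<phi> x) UNIV"
    by (rule glue, intro C_on_mult C_on_laplacian ST C_on_le[OF v'] \<phi>S) (simp_all add: laplacian_def zero2)
  then show int2: "integrable lborel (\<lambda>x. v x * laplacian \<phi> x)"
    by (intro integrable_compact_support[of _ R]) (simp_all add: laplacian_def supp2)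
  \<comment> \<open>The components of the vector field v \<nabla>\<phi> - \<phi> \<nabla>v, whose
    divergence is the difference of the two integrands.\<close>
  define g where "g i x = v x * partial i \<phi> x - \<phi> x * partial i v x" for i x
  have g: "C_on (Suc 0) (g i) UNIV" for i
    unfolding g_def[abs_def]
    by (rule glue, intro C_on_diff C_on_mult ST C_on_partial v' \<phi>S C_on_le[OF v'] C_on_le[OF \<phi>S])
       (simp_all add: zero zero1)
  have gs: "g i x = 0" if "norm x > R" for i x
    using that by (simp add: g_def supp supp1)
  have pg: "partial i (g i) x = v x * partial i (partial i \<phi>) x - \<phi> x * partial i (partial i v) x" for i x
  proof (cases "x \<in> T")
    case True
    have "partial i (g i) x = 0"
      by (rule partial_zero[OF ST(2) _ True]) (simp add: g_def zero zero1)
    then show ?thesis using True by (simp add: zero zero2)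
  next
    case False
    then have x: "x \<in> S" using ST(3) by auto
    have "has_pd i (\<lambda>x. v x * partial i \<phi> x + - (\<phi> x * partial i v x))
      ((partial i v x * partial i \<phi> x + v x * partial i (partial i \<phi>) x) +
        - (partial i \<phi> x * partial i v x + \<phi> x * partial i (partial i v) x)) x"
      using x by (intro has_pd_add has_pd_minus has_pd_mult C_on_has_pd[OF C_on_partial[OF v'] x]
          C_on_has_pd[OF C_on_partial[OF \<phi>S] x] C_on_has_pd[OF v' x] C_on_has_pd[OF \<phi>S x])
    from has_pdD(2)[OF this] show ?thesis
      by (simp add: g_def[abs_def])
  qed
  have "(\<integral>x. v x * laplacian \<phi> x \<partial>lborel) - (\<integral>x. \<phi> x * laplacian v x \<partial>lborel)
      = (\<integral>x. v x * laplacian \<phi> x - \<phi> x * laplacian v x \<partial>lborel)"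
    by (rule Bochner_Integration.integral_diff[OF int2 int1, symmetric])
  also have "\<dots> = (\<integral>x. (\<Sum>i\<in>UNIV. partial i (g i) x) \<partial>lborel)"
    by (simp add: pg laplacian_def sum_subtractf sum_distrib_left)
  also have "\<dots> = (\<Sum>i\<in>UNIV. integral\<^sup>L lborel (partial i (g i)))"
  proof (rule Bochner_Integration.integral_sum)
    fix i
    show "integrable lborel (partial i (g i))"
      using g[of i] by (intro integrable_compact_support[of _ R] partial_zero_norm_greater[OF gs]) auto
  qed
  also have "\<dots> = 0"
    using integral_partial_eq_0[OF g gs] by simp
  finally show "(\<integral>x. \<phi> x * laplacian v x \<partial>lborel) = (\<integral>x. v x * laplacian \<phi> x \<partial>lborel)"
    by simp
qed

text \<open>The induction hypothesis, applied to -\<Delta>u, moves all Laplacians but one; Green's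
  identity with empty \<open>T\<close> moves the last, since (-\<Delta>)^m \<phi> inherits the
  compact support.\<close>

lemma integral_neg_laplacian_pow:
  fixes u \<phi> :: "real ^ 'n::finite \<Rightarrow> real"
  assumes "C_on (2 * m) u UNIV" and \<phi>: "C_on (2 * m) \<phi> UNIV"
    and supp: "\<And>x. norm x > R \<Longrightarrow> \<phi> x = 0"
  shows "(\<integral>x. \<phi> x * neg_laplacian_pow m u x \<partial>lborel) = (\<integral>x. u x * neg_laplacian_pow m \<phi> x \<partial>lborel)"
  using assms(1) \<phi>
proof (induction m arbitrary: u)
  case 0
  then show ?case by (simp add: neg_laplacian_pow_0 mult.commute)
next
  case (Suc m)
  let ?w = "neg_laplacian_pow m \<phi>"
  have w: "C_on 2 ?w UNIV"
    using Suc.prems(2) by (intro C_on_neg_laplacian_pow) (auto simp del: C_on.simps)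
  have w0: "?w x = 0" if "norm x > R" for x
    by (rule neg_laplacian_pow_zero[OF open_norm_greater[of R]]) (use supp that in auto)
  have "C_on (2 * m) (\<lambda>x. - laplacian u x) UNIV"
    using Suc.prems(1) by (intro C_on_minus C_on_laplacian) (auto simp del: C_on.simps)
  then have "(\<integral>x. \<phi> x * neg_laplacian_pow (Suc m) u x \<partial>lborel) = (\<integral>x. - laplacian u x * ?w x \<partial>lborel)"
    unfolding neg_laplacian_pow_Suc by (rule Suc.IH) (rule C_on_le[OF Suc.prems(2)], simp)
  also have "\<dots> = - (\<integral>x. ?w x * laplacian u x \<partial>lborel)"
    by (simp add: mult.commute)
  also have "\<dots> = - (\<integral>x. u x * laplacian ?w x \<partial>lborel)"
    using Green_identity(3)[OF open_UNIV open_empty _ C_on_le[OF Suc.prems(1)] w _ w0] by simp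
  finally show ?case
    by (simp add: neg_laplacian_pow_Suc')
qed

section \<open>Removing the singularity at the origin\<close>

lemma partial2_mult:
  assumes f: "C_on 2 f UNIV" and g: "C_on 2 g UNIV"
  shows "partial i (partial i (\<lambda>x. f x * g x)) x =
    partial i (partial i f) x * g x + 2 * (partial i f x * partial i g x) + f x * partial i (partial i g) x"
proof -
  have f': "C_on (Suc (Suc 0)) f UNIV" and g': "C_on (Suc (Suc 0)) g UNIV"
    using f g by (simp_all add: numeral_2_eq_2)
  have "has_pd i (\<lambda>x. f x * g x) (partial i f x * g x + f x * partial i g x) x" for x
    by (intro has_pd_mult C_on_has_pd[OF f'] C_on_has_pd[OF g']) auto
  then have "partial i (\<lambda>x. f x * g x) = (\<lambda>x. partial i f x * g x + f x * partial i g x)"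
    using has_pdD(2) by blast
  moreover have "has_pd i (\<lambda>x. partial i f x * g x + f x * partial i g x)
     ((partial i (partial i f) x * g x + partial i f x * partial i g x) +
      (partial i f x * partial i g x + f x * partial i (partial i g) x)) x"
    by (intro has_pd_add has_pd_mult C_on_has_pd[OF f'] C_on_has_pd[OF g']
        C_on_has_pd[OF C_on_partial[OF f']] C_on_has_pd[OF C_on_partial[OF g']]) auto
  ultimately show ?thesis
    using has_pdD(2) by fastforce
qed

lemma laplacian_const: "laplacian (\<lambda>x :: real ^ 'n::finite. c) x = 0"
proof -
  have "partial i (\<lambda>x. c) = (\<lambda>x. 0)" for i :: 'n and c :: real
    using has_pdD(2)[OF has_pd_const] by blast
  then show ?thesis by (simp add: laplacian_def)
qed

lemma laplacian_diff:
  assumes f: "C_on 2 f UNIV" and g: "C_on 2 g UNIV"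
  shows "laplacian (\<lambda>x. f x - g x) x = laplacian f x - laplacian g x"
proof -
  have f': "C_on (Suc (Suc 0)) f UNIV" and g': "C_on (Suc (Suc 0)) g UNIV"
    using f g by (simp_all add: numeral_2_eq_2)
  have *: "has_pd i (\<lambda>x. f x - g x) (partial i f x - partial i g x) x"
    if "C_on (Suc 0) f UNIV" "C_on (Suc 0) g UNIV" for i x and f g :: "real ^ 'a \<Rightarrow> real"
    using has_pd_add[OF C_on_has_pd[OF that(1)] has_pd_minus[OF C_on_has_pd[OF that(2)]]] by simp
  have "partial i (\<lambda>x. f x - g x) = (\<lambda>x. partial i f x - partial i g x)" for i
    using has_pdD(2)[OF *[OF C_on_Suc_imp[OF f'] C_on_Suc_imp[OF g']]] by blast
  then have "partial i (partial i (\<lambda>x. f x - g x)) x = partial i (partial i f) x - partial i (partial i g) x" for i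
    using has_pdD(2)[OF *[OF C_on_partial[OF f'] C_on_partial[OF g']]] by simp
  then show ?thesis
    by (simp add: laplacian_def sum_subtractf)
qed

lemma C_2_compact_support_bound:
  fixes f :: "real ^ 'n::finite \<Rightarrow> real"
  assumes f: "C_on 2 f UNIV" and supp: "\<And>x. norm x > R \<Longrightarrow> f x = 0"
  shows "\<exists>B\<ge>0. \<forall>x. \<bar>f x\<bar> \<le> B \<and> (\<forall>i. \<bar>partial i f x\<bar> \<le> B \<and> \<bar>partial i (partial i f) x\<bar> \<le> B)"
proof -
  have f': "C_on (Suc (Suc 0)) f UNIV"
    using f by (simp add: numeral_2_eq_2)
  have s1: "partial i f x = 0" if "norm x > R" for i x
    by (rule partial_zero_norm_greater[OF supp that])
  have s2: "partial i (partial i f) x = 0" if "norm x > R" for i x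
    by (rule partial_zero_norm_greater[OF s1 that])
  obtain B0 where B0: "B0 \<ge> 0" "\<And>x. \<bar>f x\<bar> \<le> B0"
    using bounded_compact_support[OF C_on_continuous[OF f] supp] by auto
  have "\<exists>B\<ge>0. \<forall>x. \<bar>partial i f x\<bar> \<le> B" for i
    by (rule bounded_compact_support[OF C_on_continuous[OF C_on_partial[OF f']] s1])
  then obtain B1 where B1: "\<And>i. B1 i \<ge> 0" "\<And>i x. \<bar>partial i f x\<bar> \<le> B1 i"
    by metis
  have "\<exists>B\<ge>0. \<forall>x. \<bar>partial i (partial i f) x\<bar> \<le> B" for i
    by (rule bounded_compact_support[OF C_on_continuous[OF C_on_partial[OF C_on_partial[OF f']]] s2])
  then obtain B2 where B2: "\<And>i. B2 i \<ge> 0" "\<And>i x. \<bar>partial i (partial i f) x\<bar> \<le> B2 i"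
    by metis
  define B where "B = B0 + (\<Sum>i\<in>UNIV. B1 i) + (\<Sum>i\<in>UNIV. B2 i)"
  have "0 \<le> (\<Sum>i\<in>UNIV. B1 i)" "0 \<le> (\<Sum>i\<in>UNIV. B2 i)"
    using B1(1) B2(1) by (simp_all add: sum_nonneg)
  moreover have "B1 i \<le> (\<Sum>i\<in>UNIV. B1 i)" "B2 i \<le> (\<Sum>i\<in>UNIV. B2 i)" for i
    using B1(1) B2(1) by (simp_all add: member_le_sum)
  ultimately have "B0 \<le> B" "B1 i \<le> B" "B2 i \<le> B" for i
    using B0(1) by (auto simp: B_def intro: add_increasing add_increasing2)
  then show ?thesis
    using B0 B1(2) B2(2) by (intro exI[of _ B]) (meson order_trans)
qed

text \<open>Two nested truncated cubes. 1 - (|x|^2 - 1)_+^3 equals 1 on the unit ball and is at most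
  0 for |x| \<ge> 2; truncating it again removes the negative part. Third powers are just enough for
  class C^2.\<close>

lemma cutoff_exists:
  "\<exists>\<theta>. C_on 2 \<theta> UNIV \<and> (\<forall>x :: real ^ 'n::finite. 0 \<le> \<theta> x \<and> \<theta> x \<le> 1) \<and>
     (\<forall>x. norm x \<le> 1 \<longrightarrow> \<theta> x = 1) \<and> (\<forall>x. norm x \<ge> 2 \<longrightarrow> \<theta> x = 0)"
proof -
  define P where "P x = (norm x)\<^sup>2 - 1" for x :: "real ^ 'n"
  define Q where "Q x = 1 - pos_pow 3 P x" for x
  have P: "C_on 2 P UNIV"
    unfolding P_def[abs_def] by (intro C_on_diff C_on_norm_square C_on_const open_UNIV)
  have Q: "C_on 2 Q UNIV"
    unfolding Q_def[abs_def] using C_on_pos_pow[OF open_UNIV P]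
    by (intro C_on_diff C_on_const open_UNIV) (simp add: numeral_3_eq_3 numeral_2_eq_2)
  have "C_on 2 (pos_pow 3 Q) UNIV"
    using C_on_pos_pow[OF open_UNIV Q] by (simp add: numeral_3_eq_3 numeral_2_eq_2)
  moreover have "0 \<le> pos_pow 3 Q x \<and> pos_pow 3 Q x \<le> 1" for x
    by (auto simp: pos_pow_def Q_def intro!: power_le_one)
  moreover have "pos_pow 3 Q x = 1" if "norm x \<le> 1" for x
  proof -
    have "P x \<le> 0" using that by (simp add: P_def power_le_one)
    then show ?thesis by (simp add: pos_pow_def Q_def)
  qed
  moreover have "pos_pow 3 Q x = 0" if "norm x \<ge> 2" for x
  proof -
    have "2\<^sup>2 \<le> (norm x)\<^sup>2" using that by (intro power_mono) auto
    then have "1 \<le> P x" by (simp add: P_def)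
    then have "1 \<le> pos_pow 3 P x" unfolding pos_pow_def by (intro one_le_power) simp
    then show ?thesis by (simp add: pos_pow_def Q_def)
  qed
  ultimately show ?thesis by blast
qed

text \<open>With \<open>\<theta>\<close> a cutoff at scale \<open>e\<close>, the error term is the integral of \<open>v\<close> against the Laplacian of
  \<open>\<phi> \<theta>\<close>, which is \<open>O(1 / e\<^sup>2)\<close> on a ball of volume \<open>O(e ^ n)\<close>. In dimension 2 this alone is only
  bounded, but that Laplacian has integral zero, so \<open>v\<close> may be replaced by its oscillation \<open>v - v 0\<close>.\<close>

lemma superharmonic_removable:
  fixes v \<phi> :: "real ^ 'n::finite \<Rightarrow> real"
  assumes n: "CARD('n) \<ge> 2"
    and v: "C_on 2 v (UNIV - {0})" "continuous_on UNIV v"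
    and sup: "\<And>x. x \<noteq> 0 \<Longrightarrow> laplacian v x \<le> 0"
    and \<phi>: "C_on 2 \<phi> UNIV" "\<And>x. \<phi> x \<ge> 0" and supp: "\<And>x. norm x > R \<Longrightarrow> \<phi> x = 0"
    and r: "r > 0"
  shows "integrable lborel (\<lambda>x. indicator {x. norm x \<ge> r} x * (\<phi> x * - laplacian v x))"
    and "(\<integral>x. indicator {x. norm x \<ge> r} x * (\<phi> x * - laplacian v x) \<partial>lborel)
      \<le> - (\<integral>x. v x * laplacian \<phi> x \<partial>lborel)"
proof -
  let ?S = "UNIV - {0 :: real ^ 'n}"
  let ?J = "\<lambda>x. indicator {x. norm x \<ge> r} x * (\<phi> x * - laplacian v x)"
  have openS: "open ?S" by (simp add: open_delete)
  obtain \<theta> :: "real ^ 'n \<Rightarrow> real" where \<theta>: "C_on 2 \<theta> UNIV" "\<And>x. 0 \<le> \<theta> x" "\<And>x. \<theta> x \<le> 1"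
    "\<And>x. norm x \<le> 1 \<Longrightarrow> \<theta> x = 1" "\<And>x. norm x \<ge> 2 \<Longrightarrow> \<theta> x = 0"
    using cutoff_exists by metis
  obtain B where B: "B \<ge> 0" "\<And>x. \<bar>\<phi> x\<bar> \<le> B" "\<And>i x. \<bar>partial i \<phi> x\<bar> \<le> B" "\<And>i x. \<bar>partial i (partial i \<phi>) x\<bar> \<le> B"
    using C_2_compact_support_bound[OF \<phi>(1) supp] by metis
  obtain B' where B': "B' \<ge> 0" "\<And>x. \<bar>\<theta> x\<bar> \<le> B'" "\<And>i x. \<bar>partial i \<theta> x\<bar> \<le> B'" "\<And>i x. \<bar>partial i (partial i \<theta>) x\<bar> \<le> B'"
    using C_2_compact_support_bound[OF \<theta>(1), of 2] \<theta>(5) by (metis less_imp_le)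
  have \<theta>': "C_on (Suc (Suc 0)) \<theta> UNIV"
    using \<theta>(1) by (simp add: numeral_2_eq_2)
  \<comment> \<open>In each coordinate the product rule gives three terms with coefficients 1, 2, 1,
    each factor product being at most \<open>B * B'\<close>; for \<open>e \<le> 1\<close> all of
    them are of order at most 1 / e^2.\<close>
  define K where "K = real CARD('n) * (4 * (B * B'))"
  have K: "K \<ge> 0" using B(1) B'(1) by (simp add: K_def)
  define \<omega> where "\<omega> = unit_ball_vol (real CARD('n)) * 2 ^ CARD('n)"
  have \<omega>: "\<omega> \<ge> 0" by (simp add: \<omega>_def)
  \<comment> \<open>The error involves the scale \<open>e\<close> only through the oscillation bound
    \<open>d\<close>, so it can be made arbitrarily small by continuity of \<open>v\<close> at
    0.\<close>
  have main: "integrable lborel ?J \<and>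
      integral\<^sup>L lborel ?J \<le> - (\<integral>x. v x * laplacian \<phi> x \<partial>lborel) + d * K * \<omega>"
    if e: "0 < e" "e \<le> 1" "2 * e \<le> r" and d: "\<And>x. norm x \<le> 2 * e \<Longrightarrow> \<bar>v x - v 0\<bar> \<le> d" for d e
  proof -
    have d0: "d \<ge> 0" using d[of 0] e by simp
    \<comment> \<open>\<phi> is split into \<xi>, concentrated near 0, and \<psi>, which vanishes on
      \<open>ball 0 e\<close>. Green's identity therefore applies to \<psi> although
      \<open>v\<close> is singular at 0.\<close>
    define \<xi> where "\<xi> x = \<phi> x * \<theta> ((1 / e) *\<^sub>R x)" for x
    define \<psi> where "\<psi> x = \<phi> x - \<xi> x" for x
    have \<theta>e: "C_on 2 (\<lambda>x. \<theta> ((1 / e) *\<^sub>R x)) UNIV"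
      by (rule C_on_scale[OF \<theta>(1)])
    have \<xi>: "C_on 2 \<xi> UNIV"
      unfolding \<xi>_def[abs_def] by (intro C_on_mult \<phi> \<theta>e open_UNIV)
    have \<psi>: "C_on 2 \<psi> UNIV"
      unfolding \<psi>_def[abs_def] by (intro C_on_diff \<phi> \<xi> open_UNIV)
    have \<xi>_supp: "\<xi> x = 0" if "norm x > 2 * e" for x
      using that e \<theta>(5)[of "(1 / e) *\<^sub>R x"] by (simp add: \<xi>_def field_simps)
    have \<psi>_supp: "\<psi> x = 0" if "norm x > R" for x
      using that by (simp add: \<psi>_def \<xi>_def supp)
    have \<psi>_zero: "\<psi> x = 0" if "x \<in> ball 0 e" for x
      using that e \<theta>(4)[of "(1 / e) *\<^sub>R x"] by (simp add: \<psi>_def \<xi>_def field_simps)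
    have \<psi>_nonneg: "\<psi> x \<ge> 0" for x
      using mult_left_mono[OF \<theta>(3)[of "(1 / e) *\<^sub>R x"] \<phi>(2)[of x]] by (simp add: \<psi>_def \<xi>_def)
    have \<psi>_eq: "\<psi> x = \<phi> x" if "norm x \<ge> r" for x
    proof -
      have "2 * e \<le> norm x" using that e by simp
      then have "\<theta> ((1 / e) *\<^sub>R x) = 0" using e by (intro \<theta>(5)) (simp add: field_simps)
      then show ?thesis by (simp add: \<psi>_def \<xi>_def)
    qed
    have un: "?S \<union> ball 0 e = UNIV" using e by auto
    note G\<psi> = Green_identity[OF openS open_ball un v(1) \<psi> \<psi>_zero \<psi>_supp]
    have v0: "C_on 0 (\<lambda>x. v x - v 0) UNIV"
      using v(2) by (auto intro: continuous_on_diff)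
    have lap_bound: "\<bar>laplacian \<xi> x\<bar> \<le> K / e\<^sup>2" for x
    proof -
      have "\<bar>partial i (partial i \<xi>) x\<bar> \<le> 4 * (B * B') / e\<^sup>2" for i
      proof -
        let ?y = "(1 / e) *\<^sub>R x"
        have p1: "partial i (\<lambda>x. \<theta> ((1 / e) *\<^sub>R x)) = (\<lambda>x. (1 / e) * partial i \<theta> ((1 / e) *\<^sub>R x))"
          by (rule partial_scale[OF C_on_Suc_imp[OF \<theta>']])
        have "has_pd i (\<lambda>x. (1 / e) * partial i \<theta> ((1 / e) *\<^sub>R x))
            (0 * partial i \<theta> ((1 / e) *\<^sub>R x) + (1 / e) * ((1 / e) * partial i (partial i \<theta>) ?y)) x"
          by (intro has_pd_mult has_pd_const has_pd_scale C_on_has_pd[OF C_on_partial[OF \<theta>']]) auto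
        from has_pdD(2)[OF this] have p2: "partial i (partial i (\<lambda>x. \<theta> ((1 / e) *\<^sub>R x))) x
            = partial i (partial i \<theta>) ?y / e\<^sup>2"
          unfolding p1 by (simp add: power2_eq_square)
        have eq: "partial i (partial i \<xi>) x = partial i (partial i \<phi>) x * \<theta> ?y
           + 2 * (partial i \<phi> x * partial i \<theta> ?y / e) + \<phi> x * partial i (partial i \<theta>) ?y / e\<^sup>2"
          unfolding \<xi>_def[abs_def] partial2_mult[OF \<phi>(1) \<theta>e] p2 by (simp add: p1)
        have prod: "\<bar>a * b\<bar> \<le> B * B'" if "\<bar>a\<bar> \<le> B" "\<bar>b\<bar> \<le> B'" for a b
          unfolding abs_mult using that B(1) by (intro mult_mono) auto
        have triple: "\<bar>X + 2 * Y + Z\<bar> \<le> 4 * b" if "\<bar>X\<bar> \<le> b" "\<bar>Y\<bar> \<le> b" "\<bar>Z\<bar> \<le> b" for X Y Z b :: real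
          using that by linarith
        have "e\<^sup>2 \<le> 1" "e\<^sup>2 \<le> e"
          using e by (auto simp: power2_eq_square mult_le_one mult_left_le)
        then have t: "1 \<le> 1 / e\<^sup>2" "1 / e \<le> 1 / e\<^sup>2"
          using e by (auto simp: divide_simps)
        have "\<bar>partial i (partial i \<phi>) x * \<theta> ?y\<bar> \<le> B * B' * (1 / e\<^sup>2)"
          using mult_mono[OF prod t(1)] B B' by (metis mult.right_neutral abs_ge_zero mult_nonneg_nonneg zero_le_one)
        moreover have "\<bar>partial i \<phi> x * partial i \<theta> ?y / e\<bar> \<le> B * B' * (1 / e\<^sup>2)"
        proof -
          have "\<bar>partial i \<phi> x * partial i \<theta> ?y\<bar> * (1 / e) \<le> B * B' * (1 / e\<^sup>2)"
            using B B' e by (intro mult_mono prod t) auto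
          then show ?thesis using e by (simp add: abs_mult)
        qed
        moreover have "\<bar>\<phi> x * partial i (partial i \<theta>) ?y / e\<^sup>2\<bar> \<le> B * B' * (1 / e\<^sup>2)"
        proof -
          have "\<bar>\<phi> x * partial i (partial i \<theta>) ?y\<bar> * (1 / e\<^sup>2) \<le> B * B' * (1 / e\<^sup>2)"
            using B B' e by (intro mult_right_mono prod) auto
          then show ?thesis using e by (simp add: abs_mult)
        qed
        ultimately have "\<bar>partial i (partial i \<xi>) x\<bar> \<le> 4 * (B * B' * (1 / e\<^sup>2))"
          unfolding eq by (rule triple)
        then show ?thesis by simp
      qed
      then have "(\<Sum>i\<in>UNIV. \<bar>partial i (partial i \<xi>) x\<bar>) \<le> real CARD('n) * (4 * (B * B') / e\<^sup>2)"
        by (intro sum_bounded_above)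
      then show ?thesis
        unfolding laplacian_def K_def
        by (intro order_trans[OF sum_abs]) simp
    qed
    have lap_supp: "laplacian \<xi> x = 0" if "norm x > 2 * e" for x
      by (rule laplacian_zero[OF open_norm_greater[of "2 * e"]]) (use \<xi>_supp that in auto)
    have C0\<xi>: "continuous_on UNIV (laplacian \<xi>)"
      by (intro C_on_continuous[of 0] C_on_laplacian open_UNIV)
        (use \<xi> in \<open>simp add: numeral_2_eq_2\<close>)
    have C0\<phi>: "continuous_on UNIV (laplacian \<phi>)"
      by (intro C_on_continuous[of 0] C_on_laplacian open_UNIV)
        (use \<phi> in \<open>simp add: numeral_2_eq_2\<close>)
    have lap\<phi>_supp: "laplacian \<phi> x = 0" if "norm x > R" for x
      by (rule laplacian_zero[OF open_norm_greater[of R]]) (use supp that in auto)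
    have int\<xi>: "integrable lborel (\<lambda>x. v x * laplacian \<xi> x)" "integrable lborel (\<lambda>x. (v x - v 0) * laplacian \<xi> x)"
        "integrable lborel (\<lambda>x. laplacian \<xi> x)"
      using v(2) C0\<xi> by (auto intro!: integrable_compact_support[of _ "2 * e"] continuous_on_mult
          continuous_on_diff continuous_on_const simp: lap_supp)
    have int\<phi>: "integrable lborel (\<lambda>x. v x * laplacian \<phi> x)"
      using v(2) C0\<phi> by (auto intro!: integrable_compact_support[of _ R] continuous_on_mult simp: lap\<phi>_supp)
    \<comment> \<open>Green's identity against the constant function 1.\<close>
    have "(\<integral>x. laplacian \<xi> x \<partial>lborel) = 0"
      using Green_identity(3)[of UNIV "{}" "\<lambda>x. 1" \<xi> "2 * e"] C_on_const[OF open_UNIV, of 2 1] \<xi> \<xi>_supp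
      by (simp add: laplacian_const del: C_on.simps)
    then have "(\<integral>x. v x * laplacian \<xi> x \<partial>lborel) = (\<integral>x. (v x - v 0) * laplacian \<xi> x \<partial>lborel)"
      using int\<xi> by (simp add: left_diff_distrib)
    also have "\<dots> \<le> \<bar>\<integral>x. (v x - v 0) * laplacian \<xi> x \<partial>lborel\<bar>" by simp
    also have "\<dots> \<le> (d * (K / e\<^sup>2)) * unit_ball_vol (real DIM(real ^ 'n)) * (2 * e) ^ DIM(real ^ 'n)"
    proof (rule integral_bound_cball)
      show "\<bar>(v x - v 0) * laplacian \<xi> x\<bar> \<le> d * (K / e\<^sup>2)" for x
      proof (cases "norm x \<le> 2 * e")
        case True
        then show ?thesis
          unfolding abs_mult using d lap_bound d0 by (intro mult_mono) auto
      next
        case False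
        then show ?thesis using lap_supp d0 K by simp
      qed
    qed (use int\<xi> lap_supp e in auto)
    \<comment> \<open>The factor 1 / e^2 from the Laplacian cancels against the volume e^n. This is
      where dimension at least 2 enters.\<close>
    also have "\<dots> = d * K * \<omega> * e ^ (CARD('n) - 2)"
      using n e by (simp add: \<omega>_def power_mult_distrib power_diff)
    also have "\<dots> \<le> d * K * \<omega> * 1"
      using e d0 K \<omega> by (intro mult_left_mono power_le_one) auto
    finally have err: "(\<integral>x. v x * laplacian \<xi> x \<partial>lborel) \<le> d * K * \<omega>" by simp
    have intJ: "integrable lborel ?J"
    proof -
      have "integrable lborel (\<lambda>x. indicator {x. norm x \<ge> r} x *\<^sub>R (\<psi> x * laplacian v x))"
        by (intro integrable_mult_indicator G\<psi>) (auto intro!: borel_closed closed_Collect_le continuous_intros)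
      then have "integrable lborel (\<lambda>x. - (indicator {x. norm x \<ge> r} x *\<^sub>R (\<psi> x * laplacian v x)))"
        by simp
      then show ?thesis
        by (rule Bochner_Integration.integrable_cong[OF refl, THEN iffD1, rotated])
           (auto simp: indicator_def \<psi>_eq)
    qed
    have "integral\<^sup>L lborel ?J \<le> (\<integral>x. - (\<psi> x * laplacian v x) \<partial>lborel)"
    proof (rule Bochner_Integration.integral_mono[OF intJ])
      show "integrable lborel (\<lambda>x. - (\<psi> x * laplacian v x))"
        using G\<psi>(1) by simp
      \<comment> \<open>Passing to the whole space only adds nonnegative terms. At 0 itself
        \<open>laplacian v 0\<close> may be arbitrary, but \<psi> vanishes there.\<close>
      show "?J x \<le> - (\<psi> x * laplacian v x)" for x
        using \<psi>_eq[of x] \<psi>_zero[of x] \<psi>_nonneg[of x] sup[of x] e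
        by (cases "x = 0") (auto simp: indicator_def mult_le_0_iff)
    qed
    also have "\<dots> = - (\<integral>x. v x * laplacian \<psi> x \<partial>lborel)"
      using G\<psi>(3) by simp
    also have "(\<integral>x. v x * laplacian \<psi> x \<partial>lborel)
        = (\<integral>x. v x * laplacian \<phi> x \<partial>lborel) - (\<integral>x. v x * laplacian \<xi> x \<partial>lborel)"
      unfolding \<psi>_def[abs_def] laplacian_diff[OF \<phi>(1) \<xi>] right_diff_distrib
      by (rule Bochner_Integration.integral_diff[OF int\<phi> int\<xi>(1)])
    finally show ?thesis
      using err intJ by simp
  qed
  have osc: "\<exists>e>0. e \<le> 1 \<and> 2 * e \<le> r \<and> (\<forall>x. norm x \<le> 2 * e \<longrightarrow> \<bar>v x - v 0\<bar> \<le> d)" if d0: "d > 0" for d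
  proof -
    obtain s where s: "s > 0" "\<And>x. dist x 0 < s \<Longrightarrow> dist (v x) (v 0) < d"
      using v(2)[unfolded continuous_on_iff, rule_format, of 0 d, OF UNIV_I d0] by auto
    define e where "e = min 1 (min (r / 2) (s / 3))"
    have e: "0 < e" "e \<le> 1" "2 * e \<le> r" "2 * e < s"
      using s(1) r by (auto simp: e_def min_def)
    moreover have "\<bar>v x - v 0\<bar> \<le> d" if "norm x \<le> 2 * e" for x
      using s(2)[of x] that e(4) by (simp add: dist_norm)
    ultimately show ?thesis by blast
  qed
  show "integrable lborel ?J"
    using osc[of 1] main by (metis zero_less_one)
  show "integral\<^sup>L lborel ?J \<le> - (\<integral>x. v x * laplacian \<phi> x \<partial>lborel)"
  proof (rule field_le_epsilon)
    fix s :: real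
    assume s: "s > 0"
    \<comment> \<open>The summand 1 keeps the denominator positive even if
      \<open>K * \<omega>\<close> were 0.\<close>
    define d where "d = s / (K * \<omega> + 1)"
    have pos: "K * \<omega> + 1 > 0" using K \<omega> by (simp add: add_nonneg_pos)
    have "d > 0" using s pos by (simp add: d_def)
    from osc[OF this] obtain e where e: "0 < e" "e \<le> 1" "2 * e \<le> r"
      and osc_e: "\<And>x. norm x \<le> 2 * e \<Longrightarrow> \<bar>v x - v 0\<bar> \<le> d"
      by auto
    have "integral\<^sup>L lborel ?J \<le> - (\<integral>x. v x * laplacian \<phi> x \<partial>lborel) + d * K * \<omega>"
      using main[OF e osc_e] by simp
    also have "d * K * \<omega> \<le> d * (K * \<omega> + 1)"
      using \<open>d > 0\<close> by (simp add: algebra_simps)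
    also have "\<dots> = s" using pos by (simp add: d_def)
    finally show "integral\<^sup>L lborel ?J \<le> - (\<integral>x. v x * laplacian \<phi> x \<partial>lborel) + s" by simp
  qed
qed

text \<open>With l = m - 1, the function (-\<Delta>)^l u is continuous everywhere and superharmonic
  off 0, so removability disposes of the outermost Laplacian. The other l are moved by ordinary
  integration by parts, for which u in C^(2m-2) suffices.\<close>

lemma weak_polyharmonic_inequality:
  fixes u \<phi> :: "real ^ 'n::finite \<Rightarrow> real"
  assumes n: "CARD('n) \<ge> 2" and m: "m > 0"
    and u: "C_on (2 * m) u (UNIV - {0})" "C_on (2 * m - 2) u UNIV"
    and sup: "\<And>x. x \<noteq> 0 \<Longrightarrow> neg_laplacian_pow m u x \<ge> 0"
    and \<phi>: "C_on (2 * m) \<phi> UNIV" "\<And>x. \<phi> x \<ge> 0" and supp: "\<And>x. norm x > R \<Longrightarrow> \<phi> x = 0"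
    and r: "r > 0"
  shows "integrable lborel (\<lambda>x. indicator {x. norm x \<ge> r} x * (\<phi> x * neg_laplacian_pow m u x))"
    and "(\<integral>x. indicator {x. norm x \<ge> r} x * (\<phi> x * neg_laplacian_pow m u x) \<partial>lborel)
      \<le> (\<integral>x. u x * neg_laplacian_pow m \<phi> x \<partial>lborel)"
proof -
  obtain l where l: "m = Suc l"
    using m by (cases m) auto
  define v where "v = neg_laplacian_pow l u"
  have v_eq: "neg_laplacian_pow m u x = - laplacian v x" for x
    by (simp add: l v_def neg_laplacian_pow_Suc')
  have openS: "open (UNIV - {0 :: real ^ 'n})" by (simp add: open_delete)
  have v: "C_on 2 v (UNIV - {0})"
    unfolding v_def using u(1) by (intro C_on_neg_laplacian_pow openS) (simp add: l del: C_on.simps)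
  have "C_on 0 v UNIV"
    unfolding v_def using u(2) by (intro C_on_neg_laplacian_pow open_UNIV) (simp add: l del: C_on.simps)
  then have v': "continuous_on UNIV v" by simp
  have \<phi>2: "C_on 2 \<phi> UNIV"
    by (rule C_on_le[OF \<phi>(1)]) (simp add: l)
  have v_sup: "laplacian v x \<le> 0" if "x \<noteq> 0" for x
    using sup[OF that] by (simp add: v_eq)
  note rem = superharmonic_removable[OF n v v' v_sup \<phi>2 \<phi>(2) supp r]
  show "integrable lborel (\<lambda>x. indicator {x. norm x \<ge> r} x * (\<phi> x * neg_laplacian_pow m u x))"
    using rem(1) by (simp add: v_eq)
  have "(\<integral>x. indicator {x. norm x \<ge> r} x * (\<phi> x * neg_laplacian_pow m u x) \<partial>lborel)
      \<le> (\<integral>x. - laplacian \<phi> x * neg_laplacian_pow l u x \<partial>lborel)"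
    using rem(2) by (simp add: v_eq) (simp add: v_def mult.commute)
  also have "\<dots> = (\<integral>x. u x * neg_laplacian_pow l (\<lambda>x. - laplacian \<phi> x) x \<partial>lborel)"
  proof (rule integral_neg_laplacian_pow)
    show "C_on (2 * l) u UNIV" using u(2) by (simp add: l)
    show "C_on (2 * l) (\<lambda>x. - laplacian \<phi> x) UNIV"
      using \<phi>(1) by (intro C_on_minus C_on_laplacian open_UNIV) (simp add: l del: C_on.simps)
    show "- laplacian \<phi> x = 0" if "norm x > R" for x
      using laplacian_zero[OF open_norm_greater[of R], of \<phi> x] supp that by auto
  qed
  finally show "(\<integral>x. indicator {x. norm x \<ge> r} x * (\<phi> x * neg_laplacian_pow m u x) \<partial>lborel)
      \<le> (\<integral>x. u x * neg_laplacian_pow m \<phi> x \<partial>lborel)"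
    by (simp add: l neg_laplacian_pow_Suc)
qed

section \<open>The test function estimate\<close>

definition bump_base :: "real ^ 'n::finite \<Rightarrow> real" where
  "bump_base x = max 0 (1 - (norm x)\<^sup>2)"

lemma bump_base_bounds: "0 \<le> bump_base x" "bump_base x \<le> 1"
  by (auto simp: bump_base_def)

lemma bump_base_zero: "norm x \<ge> 1 \<Longrightarrow> bump_base x = 0"
  by (simp add: bump_base_def)

lemma C_on_bump: "C_on k (\<lambda>x :: real ^ 'n::finite. bump_base x ^ Suc k) UNIV"
proof -
  have "C_on k (pos_pow (Suc k) (\<lambda>x :: real ^ 'n. 1 - (norm x)\<^sup>2)) UNIV"
    by (intro C_on_pos_pow C_on_diff C_on_const C_on_norm_square open_UNIV)
  then show ?thesis
    by (simp add: pos_pow_def[abs_def] bump_base_def[abs_def])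
qed

text \<open>The smooth coefficient is bounded only on the unit ball, by compactness; outside, the
  remaining positive power of the bump is 0.\<close>

lemma neg_laplacian_pow_bump_bound:
  "\<exists>C>0. \<forall>x :: real ^ 'n::finite.
     \<bar>neg_laplacian_pow m (\<lambda>x. bump_base x ^ (2 * m + Suc j)) x\<bar> \<le> C * bump_base x ^ Suc j"
proof -
  let ?P = "\<lambda>x :: real ^ 'n. 1 - (norm x)\<^sup>2"
  have one: "\<And>k. C_on k (\<lambda>x :: real ^ 'n. 1) UNIV"
    by (intro C_on_const open_UNIV)
  have P: "\<And>k. C_on k ?P UNIV"
    by (intro C_on_diff C_on_const C_on_norm_square open_UNIV)
  obtain F where F: "\<And>k. C_on k F UNIV"
    and eq: "neg_laplacian_pow m (\<lambda>x. 1 * pos_pow (2 * m + Suc j) ?P x) = (\<lambda>x. F x * pos_pow (Suc j) ?P x)"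
    using neg_laplacian_pow_mult_pos_pow[OF one P, of m j] by blast
  have "bounded (F ` cball 0 1)"
    by (intro compact_imp_bounded compact_continuous_image continuous_on_subset[OF C_on_continuous[OF F[of 0]]]) auto
  then obtain C where C: "C > 0" "\<And>x. x \<in> cball 0 1 \<Longrightarrow> \<bar>F x\<bar> \<le> C"
    by (auto simp: bounded_pos)
  have "\<bar>F x * bump_base x ^ Suc j\<bar> \<le> C * bump_base x ^ Suc j" for x
  proof (cases "norm x \<le> 1")
    case True
    then show ?thesis
      unfolding abs_mult using C(2)[of x] bump_base_bounds(1)[of x] by (intro mult_mono) (auto simp del: power_Suc)
  next
    case False
    then show ?thesis by (simp add: bump_base_zero)
  qed
  with C(1) eq show ?thesis
    by (auto simp: pos_pow_def[abs_def] bump_base_def[abs_def] simp del: power_Suc)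
qed

text \<open>The threshold \<open>(\<alpha> / \<beta>) powr (1 / (p - 1))\<close> is the positive y
  at which \<alpha> y = \<beta> y^p. Below it the constant term dominates, above it the power
  does.\<close>

lemma Young_linear:
  fixes y \<alpha> \<beta> p :: real
  assumes "y \<ge> 0" "\<alpha> > 0" "\<beta> > 0" "p > 1"
  shows "\<alpha> * y \<le> \<beta> * y powr p + \<alpha> * (\<alpha> / \<beta>) powr (1 / (p - 1))"
proof (cases "y \<le> (\<alpha> / \<beta>) powr (1 / (p - 1))")
  case True
  then have "\<alpha> * y \<le> \<alpha> * (\<alpha> / \<beta>) powr (1 / (p - 1))"
    using assms by simp
  then show ?thesis using assms by (simp add: add_increasing)
next
  case False
  then have y: "y > 0" using order_trans[OF powr_ge_zero] by (simp add: not_le) (metis le_less_trans powr_ge_zero)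
  have "\<alpha> / \<beta> = ((\<alpha> / \<beta>) powr (1 / (p - 1))) powr (p - 1)"
    using assms by (simp add: powr_powr)
  also have "\<dots> \<le> y powr (p - 1)"
    using False assms by (intro powr_mono2) auto
  finally have "\<alpha> \<le> \<beta> * y powr (p - 1)"
    using assms by (simp add: field_simps)
  then have "\<alpha> * y \<le> \<beta> * y powr (p - 1) * y"
    using y by simp
  also have "\<dots> = \<beta> * y powr p"
    using y powr_mult_base[of y "p - 1"] by (simp add: mult_ac)
  finally show ?thesis using assms by (simp add: add_increasing2)
qed

text \<open>The weight is smallest at the outer radius if a > 0 and at the inner radius if a < 0.
  Both factors on the left are at most 1, so their product serves in either case.\<close>

lemma weight_lower_bound:
  assumes "0 < r" "r \<le> norm x" "norm x \<le> R" "1 \<le> R"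
  shows "min 1 (r powr (- a)) * R powr (- max a 0) \<le> hardy_henon_weight a x"
proof -
  consider "a = 0" | "a > 0" | "a < 0" by linarith
  then show ?thesis
  proof cases
    case 1
    then show ?thesis using assms by (simp add: hardy_henon_weight_def)
  next
    case 2
    have "min 1 (r powr (- a)) * R powr (- a) \<le> 1 * R powr (- a)"
      by (intro mult_right_mono) auto
    also have "\<dots> \<le> norm x powr (- a)"
      using 2 assms powr_mono2'[of "- a" "norm x" R] by fastforce
    finally show ?thesis using 2 by (simp add: hardy_henon_weight_def)
  next
    case 3
    have "r powr (- a) \<le> norm x powr (- a)"
      using 3 assms by (intro powr_mono2) auto
    then show ?thesis using 3 assms by (simp add: hardy_henon_weight_def)
  qed
qed

lemma hardy_henon_weight_pos: "x \<noteq> 0 \<Longrightarrow> hardy_henon_weight a x > 0"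
  by (simp add: hardy_henon_weight_def)

lemma hardy_henon_vanishes_outside:
  fixes u :: "real ^ 'n::finite \<Rightarrow> real" and m :: nat and a p :: real
  assumes n: "CARD('n) \<ge> 2" and m: "real CARD('n) / 2 < real m" and a: "a < real CARD('n)" and p: "1 < p"
    and u0: "\<And>x. u x \<ge> 0"
    and u: "C_on (2 * m) u (UNIV - {0})" "C_on (2 * m - 2) u UNIV"
    and ineq: "\<And>x. x \<noteq> 0 \<Longrightarrow> neg_laplacian_pow m u x \<ge> u x powr p * hardy_henon_weight a x"
    and r: "r > 0" and x0: "norm x0 > r"
  shows "u x0 = 0"
proof (rule ccontr)
  assume "u x0 \<noteq> 0"
  then have ux0: "u x0 > 0" using u0[of x0] by linarith
  let ?n = "CARD('n)"
  let ?f = "neg_laplacian_pow m u"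
  have f0: "?f x \<ge> 0" if "x \<noteq> 0" for x
    using ineq[OF that] hardy_henon_weight_pos[OF that, of a] powr_ge_zero[of "u x" p]
    by (meson less_imp_le mult_nonneg_nonneg order_trans)
  have mpos: "m > 0" using m n by (cases m) auto
  define A where "A = max a 0"
  have A: "0 \<le> A" "A < real ?n" using a n by (auto simp: A_def)
  define c where "c = min 1 (r powr (- a))"
  have c: "c > 0" using r by (simp add: c_def)
  \<comment> \<open>Chosen so that \<open>Suc j\<close> is at least 2m / (p - 1), which amounts to K
    / p \<le> K - 2m. For 0 \<le> w \<le> 1 this gives w^(K - 2m) \<le> w^(K / p).\<close>
  define j where "j = nat \<lceil>2 * real m / (p - 1)\<rceil>"
  define K where "K = 2 * m + Suc j"
  have Kp: "real K / p \<le> real (Suc j)"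
  proof -
    have "2 * real m / (p - 1) \<le> real (Suc j)"
      unfolding j_def by linarith
    then show ?thesis using p by (simp add: K_def field_simps)
  qed
  have uc: "continuous_on UNIV u" by (rule C_on_continuous[OF u(2)])
  have "bounded (u ` cball 0 r)"
    by (intro compact_imp_bounded compact_continuous_image continuous_on_subset[OF uc]) auto
  then obtain M where M: "M > 0" "\<And>x. norm x \<le> r \<Longrightarrow> u x \<le> M"
    by (auto simp: bounded_pos) (meson abs_le_D1 mem_cball_0)
  obtain C where C: "C > 0"
    "\<And>x :: real ^ 'n. \<bar>neg_laplacian_pow m (\<lambda>x. bump_base x ^ K) x\<bar> \<le> C * bump_base x ^ Suc j"
    using neg_laplacian_pow_bump_bound[of m j] unfolding K_def by metis
  define \<phi> where "\<phi> R x = bump_base ((1 / R) *\<^sub>R x) ^ K" for R and x :: "real ^ 'n"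
  define J where "J R x = indicator {x. norm x \<ge> r} x * (\<phi> R x * ?f x)" for R and x :: "real ^ 'n"
  have bump_smooth: "C_on (2 * m) (\<lambda>x :: real ^ 'n. bump_base x ^ K) UNIV"
    using C_on_le[OF C_on_bump[of "2 * m + j"], of "2 * m"] by (simp add: K_def del: C_on.simps power_Suc)
  have \<phi>: "C_on (2 * m) (\<phi> R) UNIV" "\<phi> R x \<ge> 0" for R x
    unfolding \<phi>_def[abs_def] using C_on_scale[OF bump_smooth] bump_base_bounds(1) by (auto intro: zero_le_power)
  have base0: "bump_base ((1 / R) *\<^sub>R x) = 0" if "norm x \<ge> R" "R > 0" for R and x :: "real ^ 'n"
    using that by (intro bump_base_zero) (simp add: field_simps)
  have supp: "\<phi> R x = 0" if "norm x > R" "R > 0" for R x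
    using base0[of R x] that by (simp add: \<phi>_def K_def)
  have weak: "integrable lborel (J R)" "integral\<^sup>L lborel (J R) \<le> (\<integral>x. u x * neg_laplacian_pow m (\<phi> R) x \<partial>lborel)"
    if "R > 0" for R
    unfolding J_def[abs_def]
    using weak_polyharmonic_inequality[OF n mpos u f0 \<phi> supp r] that by blast+
  have J0: "J R x \<ge> 0" for R x
    using \<phi>(2)[of R x] f0[of x] r by (cases "x = 0") (auto simp: J_def)
  \<comment> \<open>\<alpha> is the size of (-\<Delta>)^m of the rescaled bump. \<beta> is half the
    lower bound for the weight, so that Young's inequality costs at most half of \<open>J\<close>.
    \<open>E\<close> is the remainder it leaves.\<close>
  define \<alpha> where "\<alpha> R = C * R powr (- 2 * real m)" for R
  define \<beta> where "\<beta> R = c / 2 * R powr (- A)" for R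
  define E where "E R = \<alpha> R * (\<alpha> R / \<beta> R) powr (1 / (p - 1))" for R
  define \<omega> where "\<omega> = unit_ball_vol (real ?n)"
  have pointwise: "u x * neg_laplacian_pow m (\<phi> R) x
      \<le> J R x / 2 + \<alpha> R * M * indicator (cball 0 r) x + E R * indicator (cball 0 R) x"
    if R: "R \<ge> 1" for R x
  proof -
    have \<alpha>: "\<alpha> R > 0" and \<beta>: "\<beta> R > 0" and E: "E R \<ge> 0"
      using R C(1) c by (auto simp: \<alpha>_def \<beta>_def E_def)
    define w where "w = bump_base ((1 / R) *\<^sub>R x)"
    have w: "0 \<le> w" "w \<le> 1" using bump_base_bounds by (auto simp: w_def)
    have "neg_laplacian_pow m (\<phi> R) x = (1 / R) ^ (2 * m) * neg_laplacian_pow m (\<lambda>x. bump_base x ^ K) ((1 / R) *\<^sub>R x)"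
      unfolding \<phi>_def[abs_def] by (rule neg_laplacian_pow_scale[OF bump_smooth])
    also have "\<dots> \<le> (1 / R) ^ (2 * m) * (C * w ^ Suc j)"
      unfolding w_def using C(2) R by (intro mult_left_mono) (auto simp: abs_le_iff simp del: power_Suc)
    also have "(1 / R) ^ (2 * m) = R powr (- 2 * real m)"
      using R by (simp add: powr_minus_divide powr_realpow[symmetric] power_one_over)
    finally have "neg_laplacian_pow m (\<phi> R) x \<le> \<alpha> R * w ^ Suc j"
      by (simp add: \<alpha>_def mult_ac)
    then have le: "u x * neg_laplacian_pow m (\<phi> R) x \<le> \<alpha> R * (u x * w ^ Suc j)"
      using mult_left_mono[OF _ u0[of x]] by (metis mult.left_commute)
    \<comment> \<open>In the inner ball \<open>J\<close> is cut off and only u \<le> M is available;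
      beyond R the bump vanishes; Young's inequality is needed just in between.\<close>
    consider "norm x < r" | "norm x \<ge> r" "norm x \<ge> R" | "norm x \<ge> r" "norm x < R"
      by linarith
    then show ?thesis
    proof cases
      case 1
      then have "u x * w ^ Suc j \<le> M * 1"
        using M w u0 by (intro mult_mono power_le_one) auto
      then have "\<alpha> R * (u x * w ^ Suc j) \<le> \<alpha> R * M"
        using \<alpha> by simp
      with le 1 E J0[of R x] show ?thesis by (auto simp: indicator_def)
    next
      case 2
      then have "w = 0" using base0[of R x] R by (simp add: w_def)
      then have "u x * neg_laplacian_pow m (\<phi> R) x \<le> 0" using le by simp
      also have "0 \<le> J R x / 2 + \<alpha> R * M * indicator (cball 0 r) x + E R * indicator (cball 0 R) x"
        using E J0[of R x] \<alpha> M(1) by simp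
      finally show ?thesis .
    next
      case 3
      \<comment> \<open>The power of w is chosen so that y^p = u^p w^K, which is the lower bound for
        the integrand of \<open>J\<close> apart from the weight.\<close>
      define y where "y = u x * w powr (real K / p)"
      have y: "y \<ge> 0" using u0 by (simp add: y_def)
      have "w ^ Suc j \<le> w powr (real K / p)"
      proof (cases "w = 0")
        case False
        then have "w ^ Suc j = w powr real (Suc j)"
          using w by (intro powr_realpow[symmetric]) auto
        also have "\<dots> \<le> w powr (real K / p)"
          using Kp w False by (intro powr_mono') auto
        finally show ?thesis .
      qed simp
      then have "\<alpha> R * (u x * w ^ Suc j) \<le> \<alpha> R * y"
        unfolding y_def using \<alpha> u0 by (intro mult_left_mono) auto
      also have "\<dots> \<le> \<beta> R * y powr p + E R"
        unfolding E_def by (rule Young_linear[OF y \<alpha> \<beta> p])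
      also have "y powr p = u x powr p * w ^ K"
      proof (cases "w = 0")
        case True
        then show ?thesis using p by (simp add: y_def K_def)
      next
        case False
        then show ?thesis using p w u0[of x]
          by (simp add: y_def powr_mult powr_powr powr_realpow)
      qed
      also have "\<beta> R * (u x powr p * w ^ K) \<le> J R x / 2"
      proof -
        have "c * R powr (- A) \<le> hardy_henon_weight a x"
          unfolding c_def A_def using r 3 R by (intro weight_lower_bound) auto
        then have "u x powr p * (c * R powr (- A)) \<le> u x powr p * hardy_henon_weight a x"
          by (intro mult_left_mono) auto
        also have "\<dots> \<le> ?f x"
          using 3 r by (intro ineq) auto
        finally have "w ^ K * (u x powr p * (c * R powr (- A))) \<le> w ^ K * ?f x"
          using w by (intro mult_left_mono) auto
        moreover have "J R x = w ^ K * ?f x"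
          using 3 by (simp add: J_def \<phi>_def w_def)
        ultimately show ?thesis by (simp add: \<beta>_def mult_ac)
      qed
      finally have "\<alpha> R * (u x * w ^ Suc j) \<le> J R x / 2 + E R" by simp
      moreover have "0 \<le> \<alpha> R * M * indicator (cball 0 r) x" using \<alpha> M by simp
      ultimately show ?thesis using le 3 by (simp add: indicator_def)
    qed
  qed
  \<comment> \<open>Integrating the pointwise bound gives J \<le> J / 2 + T / 2 for the integral of
    \<open>J\<close>. This integral is finite, so half of it can be subtracted.\<close>
  define T where "T R = 2 * (\<alpha> R * M * \<omega> * r ^ ?n + E R * \<omega> * R ^ ?n)" for R
  have J_le_T: "integral\<^sup>L lborel (J R) \<le> T R" if R: "R \<ge> 1" for R
  proof -
    have ball: "integrable lborel (indicator (cball (0 :: real ^ 'n) s) :: _ \<Rightarrow> real)"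
      "(\<integral>x. indicator (cball (0 :: real ^ 'n) s) x \<partial>lborel) = \<omega> * s ^ ?n" if "s \<ge> 0" for s
      using emeasure_compact_finite[of "cball (0::real ^ 'n) s"] that
      by (auto simp: less_top content_cball \<omega>_def)
    have int: "integrable lborel (\<lambda>x. J R x / 2)" "integrable lborel (\<lambda>x :: real ^ 'n. \<alpha> R * M * indicator (cball 0 r) x)"
      "integrable lborel (\<lambda>x :: real ^ 'n. E R * indicator (cball 0 R) x)"
      using weak(1)[of R] ball(1) r R by auto
    have w: "continuous_on UNIV (neg_laplacian_pow m (\<phi> R))"
      using C_on_neg_laplacian_pow[OF open_UNIV, of 0 m "\<phi> R"] \<phi>(1) by simp
    have w0: "neg_laplacian_pow m (\<phi> R) x = 0" if "norm x > R" for x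
      by (rule neg_laplacian_pow_zero[OF open_norm_greater[of R]]) (use supp that R in auto)
    have "integral\<^sup>L lborel (J R) \<le> (\<integral>x. u x * neg_laplacian_pow m (\<phi> R) x \<partial>lborel)"
      using weak(2)[of R] R by simp
    also have "\<dots> \<le> (\<integral>x. J R x / 2 + \<alpha> R * M * indicator (cball 0 r) x + E R * indicator (cball 0 R) x \<partial>lborel)"
    proof (rule Bochner_Integration.integral_mono)
      show "integrable lborel (\<lambda>x. u x * neg_laplacian_pow m (\<phi> R) x)"
        by (rule integrable_compact_support[of _ R]) (use uc w w0 in \<open>auto intro: continuous_on_mult\<close>)
      show "integrable lborel (\<lambda>x. J R x / 2 + \<alpha> R * M * indicator (cball 0 r) x + E R * indicator (cball 0 R) x)"
        by (intro Bochner_Integration.integrable_add int)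
    qed (use pointwise[OF R] in simp)
    also have "\<dots> = integral\<^sup>L lborel (J R) / 2 + T R / 2"
      using int ball(2) r R by (simp add: Bochner_Integration.integral_add[OF Bochner_Integration.integrable_add[OF int(1,2)] int(3)]
          Bochner_Integration.integral_add[OF int(1,2)] T_def)
    finally show ?thesis by simp
  qed
  have T_lim: "(T \<longlongrightarrow> 0) at_top"
  proof -
    \<comment> \<open>The volume of the ball contributes n, \<alpha> contributes -2m, and the power
      of \<alpha> / \<beta> contributes the quotient. Both n - 2m and A - 2m are negative.\<close>
    define q where "q = real ?n - 2 * real m + (A - 2 * real m) / (p - 1)"
    have q: "q < 0"
    proof -
      have "(A - 2 * real m) / (p - 1) < 0" using A m p by (intro divide_neg_pos) auto
      then show ?thesis using m by (simp add: q_def)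
    qed
    define D where "D = C * (2 * C / c) powr (1 / (p - 1)) * \<omega>"
    have T_eq: "T R = 2 * (C * M * \<omega> * r ^ ?n * R powr (- 2 * real m) + D * R powr q)" if R: "R > 0" for R
    proof -
      have "\<alpha> R / \<beta> R = 2 * C / c * R powr (A - 2 * real m)"
        using R c by (simp add: \<alpha>_def \<beta>_def powr_diff powr_minus field_simps)
      then have "(\<alpha> R / \<beta> R) powr (1 / (p - 1))
          = (2 * C / c) powr (1 / (p - 1)) * (R powr (A - 2 * real m)) powr (1 / (p - 1))"
        using c C(1) by (simp only:) (intro powr_mult; simp)
      then have "(\<alpha> R / \<beta> R) powr (1 / (p - 1))
          = (2 * C / c) powr (1 / (p - 1)) * R powr ((A - 2 * real m) / (p - 1))"
        by (simp add: powr_powr)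
      moreover have "R ^ ?n = R powr real ?n" using R by (simp add: powr_realpow)
      moreover have "R powr q = R powr (- 2 * real m) * R powr ((A - 2 * real m) / (p - 1)) * R powr real ?n"
        unfolding powr_add[symmetric] by (simp add: q_def algebra_simps)
      ultimately have "E R * \<omega> * R ^ ?n = D * R powr q"
        by (simp add: E_def D_def \<alpha>_def mult_ac)
      then show ?thesis by (simp add: T_def \<alpha>_def mult_ac)
    qed
    have "((\<lambda>R. 2 * (C * M * \<omega> * r ^ ?n * R powr (- 2 * real m) + D * R powr q))
        \<longlongrightarrow> 2 * (C * M * \<omega> * r ^ ?n * 0 + D * 0)) at_top"
      using q mpos by (intro tendsto_intros tendsto_neg_powr filterlim_ident) auto
    then have "((\<lambda>R. 2 * (C * M * \<omega> * r ^ ?n * R powr (- 2 * real m) + D * R powr q)) \<longlongrightarrow> 0) at_top"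
      by simp
    then show ?thesis
      by (rule Lim_transform_eventually) (rule eventually_mono[OF eventually_gt_at_top[of 0]], rule T_eq[symmetric])
  qed
  define R0 where "R0 = norm x0 + 1"
  have R0: "R0 \<ge> 1" "R0 > 0" by (auto simp: R0_def add_nonneg_pos)
  have "integral\<^sup>L lborel (J R0) \<le> 0"
  proof (rule tendsto_lowerbound[OF T_lim])
    show "\<forall>\<^sub>F R in at_top. integral\<^sup>L lborel (J R0) \<le> T R"
      using eventually_ge_at_top[of R0]
    proof eventually_elim
      case (elim R)
      \<comment> \<open>Dilation raises the bump pointwise, and (-\<Delta>)^m u is nonnegative off
        0; at 0 the indicator kills both sides.\<close>
      have "integral\<^sup>L lborel (J R0) \<le> integral\<^sup>L lborel (J R)"
      proof (rule Bochner_Integration.integral_mono)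
        show "J R0 x \<le> J R x" for x
        proof (cases "x = 0")
          case True
          then show ?thesis using r by (simp add: J_def)
        next
          case False
          have "norm ((1 / R) *\<^sub>R x) \<le> norm ((1 / R0) *\<^sub>R x)"
            using elim R0 by (simp add: frac_le)
          then have "(norm ((1 / R) *\<^sub>R x))\<^sup>2 \<le> (norm ((1 / R0) *\<^sub>R x))\<^sup>2"
            by (intro power_mono) auto
          then have "bump_base ((1 / R0) *\<^sub>R x) \<le> bump_base ((1 / R) *\<^sub>R x)"
            unfolding bump_base_def by linarith
          then have "\<phi> R0 x \<le> \<phi> R x"
            unfolding \<phi>_def using bump_base_bounds by (intro power_mono) auto
          then show ?thesis
            unfolding J_def using f0[OF False] by (intro mult_left_mono mult_right_mono) auto
        qed
      qed (use weak(1) R0 elim in auto)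
      then show ?case using J_le_T[of R] elim R0 by simp
    qed
  qed simp
  moreover have "integral\<^sup>L lborel (J R0) \<ge> 0"
    using J0 by (intro Bochner_Integration.integral_nonneg) auto
  ultimately have J_AE: "AE x in lborel. J R0 x = 0"
    using integral_nonneg_eq_0_iff_AE[OF weak(1)[OF R0(2)]] J0 by simp
  \<comment> \<open>\<open>J R0\<close> is positive throughout this open set but vanishes almost
    everywhere. An open null set is empty, whereas \<open>x0\<close> belongs to it.\<close>
  define U where "U = {x. r < norm x} \<inter> {x. norm x < R0} \<inter> {x. 0 < u x}"
  have J_pos: "J R0 x > 0" if "x \<in> U" for x
  proof -
    have x: "x \<noteq> 0" "r \<le> norm x" "norm x < R0" "u x > 0"
      using that r by (auto simp: U_def)
    have "u x powr p * hardy_henon_weight a x > 0"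
      using x hardy_henon_weight_pos[OF x(1)] by simp
    then have "?f x > 0" using ineq[OF x(1)] by linarith
    moreover have "(norm ((1 / R0) *\<^sub>R x))\<^sup>2 < 1"
      using x(3) R0 by (intro power_less_one_iff[THEN iffD2]) (auto simp: field_simps)
    then have "\<phi> R0 x > 0" by (simp add: \<phi>_def bump_base_def)
    ultimately show ?thesis using x(2) by (simp add: J_def)
  qed
  have "AE x in lborel. x \<notin> U"
    using J_AE by eventually_elim (metis J_pos less_irrefl)
  have "open U"
    unfolding U_def using uc by (intro open_Int open_Collect_less continuous_intros) auto
  then have "U \<in> sets lborel" by simp
  with \<open>AE x in lborel. x \<notin> U\<close> have "U \<in> null_sets lborel"
    by (simp add: AE_iff_null_sets)
  then have "negligible U"
    by (simp add: negligible_iff_null_sets null_sets_completionI)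
  moreover have "x0 \<in> U"
    using x0 ux0 by (simp add: U_def R0_def)
  ultimately show False
    using open_not_negligible[OF \<open>open U\<close>] by auto
qed

theorem theorem1p7:
  fixes u :: "real ^ 'n::finite \<Rightarrow> real" and m :: nat and a p :: real
  assumes "CARD('n) \<ge> 2"
    and "real CARD('n) / 2 < real m"
    and "a < real CARD('n)"
    and "1 < p"
    and "\<And>x. u x \<ge> 0"
    and "classical_solution m a p u"
    and "a \<le> 2 + 2 * p \<or> u \<in> o[at_infinity](\<lambda>x. (norm x)\<^sup>2)"
  shows "\<forall>x. u x = 0"
proof -
  \<comment> \<open>For a \<le> 0 the solution also has the weaker regularity and satisfies the
    inequality off the origin, so both ranges of a are treated as the singular one.\<close>
  have u: "C_on (2 * m) u (UNIV - {0})" "C_on (2 * m - 2) u UNIV"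
    and ineq: "\<And>x. x \<noteq> 0 \<Longrightarrow> neg_laplacian_pow m u x \<ge> u x powr p * hardy_henon_weight a x"
    using assms(6) C_on_subset[of "2 * m" u UNIV "UNIV - {0}"] C_on_le[of "2 * m" u UNIV "2 * m - 2"]
    by (auto simp: classical_solution_def split: if_splits)
  have off: "u x = 0" if "x \<in> - {0}" for x
    by (rule hardy_henon_vanishes_outside[OF assms(1-5) u ineq, of "norm x / 2"]) (use that in auto)
  \<comment> \<open>The origin is a limit of other points, so continuity carries the value 0 over to
    it.\<close>
  have cl: "closure (- {0 :: real ^ 'n}) = UNIV"
    by (simp add: closure_complement)
  have "u x = 0" for x
    by (rule continuous_constant_on_closure[of "- {0}" u 0 x])
       (use off C_on_continuous[OF u(2)] in \<open>simp_all only: cl UNIV_I\<close>)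
  then show ?thesis by simp
qed

end
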